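(* Let $(M,d)$ be a uniformly discrete, bounded pointed metric space with at least two points. Then the following are equivalent. (1) The norm of $\mathcal{F}(M)$ is non-rough. (2) $Lip_0(M)=\mathcal{F}(M)^*$ has the $w^*$-$BDP$. (3) For each $\varepsilon>0$ there exist $\alpha>0$, $n\in\mathbb{N}$ (with $n\geq 1$) and a finite indexed family $\{(x_i,y_i)\}_{i=1}^{n}$ in $(M\times M)\setminus\{(x,x):x\in M\}$ such that all of the following hold: (a) for every pair of different indices $j,k\in\{1,\ldots,n\}$ there exists a finite sequence of different indices $i_1,\ldots,i_m\in\{1,\ldots,n\}$ that contains both $j$ and $k$ and satisfies $$d(x_{i_1},y_{i_2})+\ldots+d(x_{i_{m-1}},y_{i_m})+d(x_{i_m},y_{i_1})-\varepsilon< d(x_{i_1},y_{i_1})+\ldots+d(x_{i_m},y_{i_m});$$ (b) for every finite sequence $i_1,\ldots,i_m\in\{1,\ldots,n\}$ we have $$d(x_{i_1},y_{i_1})+\ldots+d(x_{i_m},y_{i_m})\leqslant d(x_{i_1},y_{i_2})+\ldots+d(x_{i_{m-1}},y_{i_m})+d(x_{i_m},y_{i_1});$$ (c) for every $x\in M$ there exist $s,t\in\{x_1,y_1,\ldots,x_n,y_n\}$ with $s\neq t$ such that $$d(x,s)+d(x,t)<d(s,t)+\varepsilon,$$ and such that for every $1$-Lipschitz map $f:M\rightarrow\mathbb{R}$ with $f(x_i)-f(y_i)>d(x_i,y_i)(1-\alpha)$ for all $i=1,\ldots,n$, we have $$f(t)-f(s)>d(s,t)-\varepsilon.$$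
   Context: All Banach spaces are real and nontrivial. For a Banach space $X$, $B_X$ is the closed unit ball, $S_X$ the unit sphere, and $X^*$ the dual. A pointed metric space is a metric space $(M,d)$ with a designated origin $0\in M$. It is uniformly discrete if $\inf\{d(x,y):x,y\in M,\ x\neq y\}>0$. $Lip_0(M)$ is the Banach space of all Lipschitz functions $f:M\to\mathbb{R}$ with $f(0)=0$, with norm $\|f\|=\sup\left\{\frac{|f(x)-f(y)|}{d(x,y)}:x\neq y\right\}$. For $m\in M$, $\delta_m\in Lip_0(M)^*$ is defined by $\delta_m(f)=f(m)$. The Lipschitz-free space over $M$ is $\mathcal{F}(M)=\overline{\mathrm{span}}\{\delta_m:m\in M\}\subset Lip_0(M)^*$ (norm closure, with the norm of $Lip_0(M)^*$). Its dual $\mathcal{F}(M)^*$ is identified with $Lip_0(M)$ via the evaluation pairing. Non-rough norm: for $u\in S_X$ put $$\eta(X,u)=\limsup_{\|h\|\to 0}\frac{\|u+h\|+\|u-h\|-2}{\|h\|}.$$ For $\varepsilon>0$ the norm of $X$ is $\varepsilon$-rough if $\eta(X,u)\geq\varepsilon$ for every $u\in S_X$. It is rough if it is $\varepsilon$-rough for some $\varepsilon>0$, and non-rough otherwise. A $w^*$-slice of $B_{X^*}$ is a set of the form $S(B_{X^*},x,\alpha)=\{x^*\in B_{X^*}:x^*(x)>1-\alpha\}$ with $x\in S_X$ and $\alpha>0$. The dual space $X^*$ has the $w^*$-$BDP$ ($w^*$-Ball Dentable Property) if $B_{X^*}$ has $w^*$-slices of arbitrarily small diameter (norm diameter), i.e.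 for each $\varepsilon>0$ there is a $w^*$-slice of $B_{X^*}$ of diameter less than $\varepsilon$. In the sums in (a) and (b), indices are cyclic: for $m=1$ the sum $d(x_{i_1},y_{i_2})+\ldots+d(x_{i_{m-1}},y_{i_m})+d(x_{i_m},y_{i_1})$ means $d(x_{i_1},y_{i_1})$. *)

theory Defs
  imports "HOL-Analysis.Analysis"
begin

section \<open>Roughness and the \<open>w\<^sup>*\<close>-ball dentable property\<close>

text \<open>The \<open>limsup\<close> is taken in the extended reals, a complete lattice; the quotient lies in
  \<open>[0, 2]\<close> for \<open>norm u = 1\<close>. The filter \<open>at 0\<close> excludes \<open>h = 0\<close>.\<close>

definition roughness_eta :: "'x::real_normed_vector \<Rightarrow> ereal" where
  "roughness_eta u =
     Limsup (at 0) (\<lambda>h. ereal ((norm (u + h) + norm (u - h) - 2) / norm h))"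

definition eps_rough_norm :: "real \<Rightarrow> 'x::real_normed_vector itself \<Rightarrow> bool" where
  "eps_rough_norm \<epsilon> X \<longleftrightarrow> (\<forall>u::'x. norm u = 1 \<longrightarrow> ereal \<epsilon> \<le> roughness_eta u)"

definition rough_norm :: "'x::real_normed_vector itself \<Rightarrow> bool" where
  "rough_norm X \<longleftrightarrow> (\<exists>\<epsilon>>0. eps_rough_norm \<epsilon> X)"

definition wstar_slice :: "'x::real_normed_vector \<Rightarrow> real \<Rightarrow> ('x \<Rightarrow>\<^sub>L real) set" where
  "wstar_slice x \<alpha> = {g \<in> cball 0 1. blinfun_apply g x > 1 - \<alpha>}"

text \<open>The argument is the predual \<open>X\<close>; the property is one of the dual \<open>X \<Rightarrow>\<^sub>L real\<close>.\<close>

definition dual_wstar_BDP :: "'x::real_normed_vector itself \<Rightarrow> bool" where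
  "dual_wstar_BDP X \<longleftrightarrow>
     (\<forall>\<epsilon>>0. \<exists>(x::'x) \<alpha>. norm x = 1 \<and> \<alpha> > 0 \<and> diameter (wstar_slice x \<alpha>) < \<epsilon>)"


section \<open>The space \<open>Lip\<^sub>0(M)\<close>\<close>

text \<open>A pointed metric space is a type of sort \<open>{metric_space, zero}\<close>: the constant \<open>0\<close> of the
  purely syntactic class \<^class>\<open>zero\<close> is the designated origin, and no further property of it
  is assumed.\<close>

typedef (overloaded) ('a::"{metric_space,zero}") lip0 =
    "{f :: 'a \<Rightarrow> real. f 0 = 0 \<and> (\<exists>C. C-lipschitz_on UNIV f)}"
  morphisms lip0_apply Lip0
  by (rule exI[of _ "\<lambda>_. 0"]) (auto simp: lipschitz_on_def)

setup_lifting type_definition_lip0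

lemma lip0_ex_bound: "\<exists>C\<ge>0. \<forall>x y. \<bar>lip0_apply f x - lip0_apply f y\<bar> \<le> C * dist x y"
  using lip0_apply[of f] by (auto simp: lipschitz_on_def dist_real_def)

instantiation lip0 :: ("{metric_space,zero}") real_vector
begin

lift_definition zero_lip0 :: "'a lip0" is "\<lambda>_. 0"
  by (auto simp: lipschitz_on_def)

lift_definition plus_lip0 :: "'a lip0 \<Rightarrow> 'a lip0 \<Rightarrow> 'a lip0" is "\<lambda>f g x. f x + g x"
  by (simp, blast intro: lipschitz_on_add)

lift_definition minus_lip0 :: "'a lip0 \<Rightarrow> 'a lip0 \<Rightarrow> 'a lip0" is "\<lambda>f g x. f x - g x"
  by (simp, blast intro: lipschitz_on_diff)

lift_definition uminus_lip0 :: "'a lip0 \<Rightarrow> 'a lip0" is "\<lambda>f x. - f x"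
  by simp

lift_definition scaleR_lip0 :: "real \<Rightarrow> 'a lip0 \<Rightarrow> 'a lip0" is "\<lambda>r f x. r * f x"
  by (simp, blast intro: lipschitz_on_cmult_real)

instance
proof
  fix f g h :: "'a lip0" and a b :: real
  show "f + g + h = f + (g + h)" by transfer (auto simp: algebra_simps)
  show "f + g = g + f" by transfer (auto simp: algebra_simps)
  show "0 + f = f" by transfer auto
  show "- f + f = 0" by transfer auto
  show "f - g = f + - g" by transfer auto
  show "a *\<^sub>R (f + g) = a *\<^sub>R f + a *\<^sub>R g" by transfer (auto simp: algebra_simps)
  show "(a + b) *\<^sub>R f = a *\<^sub>R f + b *\<^sub>R f" by transfer (auto simp: algebra_simps)
  show "a *\<^sub>R b *\<^sub>R f = (a * b) *\<^sub>R f" by transfer (auto simp: algebra_simps)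
  show "1 *\<^sub>R f = f" by transfer auto
qed

end

lemma lip0_bdd_above:
  "bdd_above (range (\<lambda>(x, y). \<bar>lip0_apply f x - lip0_apply f y\<bar> / dist x y))"
proof -
  obtain C where C: "C \<ge> 0" "\<And>x y. \<bar>lip0_apply f x - lip0_apply f y\<bar> \<le> C * dist x y"
    using lip0_ex_bound by blast
  show ?thesis
  proof (rule bdd_aboveI2)
    fix p
    show "(case p of (x, y) \<Rightarrow> \<bar>lip0_apply f x - lip0_apply f y\<bar> / dist x y) \<le> C"
      using C by (cases p; cases "fst p = snd p") (auto simp: divide_le_eq)
  qed
qed

instantiation lip0 :: ("{metric_space,zero}") real_normed_vector
begin

text \<open>The supremum runs over all pairs; as \<open>r / 0 = 0\<close>, a diagonal pair only contributes the
  value \<open>0\<close>, so this is the supremum over \<open>x \<noteq> y\<close> (and \<open>0\<close> on a one-point space).\<close>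

definition norm_lip0 :: "'a lip0 \<Rightarrow> real" where
  "norm_lip0 f = (SUP (x, y). \<bar>lip0_apply f x - lip0_apply f y\<bar> / dist x y)"

definition dist_lip0 :: "'a lip0 \<Rightarrow> 'a lip0 \<Rightarrow> real" where
  "dist_lip0 f g = norm (f - g)"

definition sgn_lip0 :: "'a lip0 \<Rightarrow> 'a lip0" where
  "sgn_lip0 f = f /\<^sub>R norm f"

definition uniformity_lip0 :: "('a lip0 \<times> 'a lip0) filter" where
  "uniformity_lip0 = (INF e\<in>{0<..}. principal {(f, g). dist f g < e})"

definition open_lip0 :: "'a lip0 set \<Rightarrow> bool" where
  "open_lip0 U = (\<forall>f\<in>U. eventually (\<lambda>(f', g). f' = f \<longrightarrow> g \<in> U) uniformity)"

lemma norm_lip0_le: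
  fixes f :: "'a lip0"
  assumes "C \<ge> 0" and "\<And>x y. \<bar>lip0_apply f x - lip0_apply f y\<bar> \<le> C * dist x y"
  shows "norm f \<le> C"
  unfolding norm_lip0_def
proof (rule cSUP_least)
  fix p :: "'a \<times> 'a"
  show "(case p of (x, y) \<Rightarrow> \<bar>lip0_apply f x - lip0_apply f y\<bar> / dist x y) \<le> C"
    using assms by (cases p; cases "fst p = snd p") (auto simp: divide_le_eq)
qed auto

lemma lip0_diff_le:
  fixes f :: "'a lip0"
  shows "\<bar>lip0_apply f x - lip0_apply f y\<bar> \<le> norm f * dist x y"
proof (cases "x = y")
  case False
  from cSUP_upper[OF _ lip0_bdd_above[of f], of "(x, y)"]
  have "\<bar>lip0_apply f x - lip0_apply f y\<bar> / dist x y \<le> norm f"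
    unfolding norm_lip0_def by simp
  with False show ?thesis by (simp add: divide_le_eq)
qed simp

lemma norm_lip0_nonneg: "0 \<le> norm (f :: 'a lip0)"
proof -
  from cSUP_upper[OF _ lip0_bdd_above[of f], of "(0, 0)"] show ?thesis
    unfolding norm_lip0_def by simp
qed

instance
proof
  fix f g :: "'a lip0" and a :: real
  show "dist f g = norm (f - g)" by (rule dist_lip0_def)
  show "sgn f = f /\<^sub>R norm f" by (rule sgn_lip0_def)
  show "(uniformity :: ('a lip0 \<times> 'a lip0) filter) = (INF e\<in>{0<..}. principal {(f, g). dist f g < e})"
    by (rule uniformity_lip0_def)
  show "open U = (\<forall>f\<in>U. eventually (\<lambda>(f', g). f' = f \<longrightarrow> g \<in> U) uniformity)" for U :: "'a lip0 set"
    by (rule open_lip0_def)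
  show "norm f = 0 \<longleftrightarrow> f = 0"
  proof
    assume "norm f = 0"
    then have "lip0_apply f x = lip0_apply f 0" for x
      using lip0_diff_le[of f x 0] by simp
    moreover have "lip0_apply f 0 = 0" using lip0_apply[of f] by simp
    ultimately show "f = 0" by transfer auto
  next
    assume "f = 0"
    moreover have "norm (0 :: 'a lip0) \<le> 0"
      by (rule norm_lip0_le) (auto simp: zero_lip0.rep_eq)
    ultimately show "norm f = 0" using norm_lip0_nonneg[of f] by simp
  qed
  show "norm (f + g) \<le> norm f + norm g"
  proof (rule norm_lip0_le)
    show "0 \<le> norm f + norm g" using norm_lip0_nonneg by (simp add: add_nonneg_nonneg)
    fix x y :: 'a
    show "\<bar>lip0_apply (f + g) x - lip0_apply (f + g) y\<bar> \<le> (norm f + norm g) * dist x y"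
      using lip0_diff_le[of f x y] lip0_diff_le[of g x y]
      by (simp add: plus_lip0.rep_eq algebra_simps)
  qed
  have scale: "norm (a *\<^sub>R f) \<le> \<bar>a\<bar> * norm f" for a and f :: "'a lip0"
  proof (rule norm_lip0_le)
    show "0 \<le> \<bar>a\<bar> * norm f" using norm_lip0_nonneg by simp
    fix x y :: 'a
    have "\<bar>lip0_apply (a *\<^sub>R f) x - lip0_apply (a *\<^sub>R f) y\<bar>
        = \<bar>a\<bar> * \<bar>lip0_apply f x - lip0_apply f y\<bar>"
      by (simp add: scaleR_lip0.rep_eq flip: abs_mult right_diff_distrib)
    also have "\<dots> \<le> \<bar>a\<bar> * (norm f * dist x y)"
      by (intro mult_left_mono lip0_diff_le) auto
    finally show "\<bar>lip0_apply (a *\<^sub>R f) x - lip0_apply (a *\<^sub>R f) y\<bar> \<le> \<bar>a\<bar> * norm f * dist x y"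
      by (simp add: mult.assoc)
  qed
  show "norm (a *\<^sub>R f) = \<bar>a\<bar> * norm f"
  proof (cases "a = 0")
    case True
    then show ?thesis using scale[of a f] norm_lip0_nonneg[of "a *\<^sub>R f"] by simp
  next
    case False
    have "f = inverse a *\<^sub>R a *\<^sub>R f" using False by transfer auto
    then have "norm f \<le> \<bar>inverse a\<bar> * norm (a *\<^sub>R f)" by (metis scale)
    then have "\<bar>a\<bar> * norm f \<le> norm (a *\<^sub>R f)" using False by (simp add: field_simps abs_inverse)
    with scale[of a f] show ?thesis by simp
  qed
qed

end

lemma lip0_apply_0 [simp]: "lip0_apply f 0 = 0"
  using lip0_apply[of f] by simp


section \<open>The Lipschitz-free space\<close>

lift_definition lip0_eval :: "'a::{metric_space,zero} \<Rightarrow> 'a lip0 \<Rightarrow>\<^sub>L real" is "\<lambda>m f. lip0_apply f m"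
proof -
  fix m :: 'a
  show "bounded_linear (\<lambda>f. lip0_apply f m)"
  proof (rule bounded_linear_intro[of _ "dist m 0"])
    fix f :: "'a lip0"
    show "norm (lip0_apply f m) \<le> norm f * dist m 0"
      using lip0_diff_le[of f m 0] by simp
  qed (auto simp: plus_lip0.rep_eq scaleR_lip0.rep_eq)
qed

typedef (overloaded) ('a::"{metric_space,zero}") lipfree =
    "closure (span (range lip0_eval)) :: ('a lip0 \<Rightarrow>\<^sub>L real) set"
  morphisms lipfree_functional Lipfree
  by (rule exI[of _ 0]) (rule subsetD[OF closure_subset span_zero])

setup_lifting type_definition_lipfree

lemma subspace_closure_span: "subspace (closure (span A))" for A :: "'x::real_normed_vector set"
  unfolding subspace_def
proof (intro conjI ballI allI)
  show "0 \<in> closure (span A)" by (rule subsetD[OF closure_subset span_zero])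
next
  fix x y assume "x \<in> closure (span A)" "y \<in> closure (span A)"
  then obtain u v where "\<And>n. u n \<in> span A" "u \<longlonglongrightarrow> x" "\<And>n. v n \<in> span A" "v \<longlonglongrightarrow> y"
    unfolding closure_sequential by blast
  then have "\<forall>n. u n + v n \<in> span A" "(\<lambda>n. u n + v n) \<longlonglongrightarrow> x + y"
    by (auto intro: span_add tendsto_add)
  then show "x + y \<in> closure (span A)"
    unfolding closure_sequential by (intro exI[of _ "\<lambda>n. u n + v n"]) blast
next
  fix c x assume "x \<in> closure (span A)"
  then obtain u where "\<And>n. u n \<in> span A" "u \<longlonglongrightarrow> x"
    unfolding closure_sequential by blast
  then have "\<forall>n. c *\<^sub>R u n \<in> span A" "(\<lambda>n. c *\<^sub>R u n) \<longlonglongrightarrow> c *\<^sub>R x"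
    by (auto intro: span_scale tendsto_scaleR)
  then show "c *\<^sub>R x \<in> closure (span A)"
    unfolding closure_sequential by (intro exI[of _ "\<lambda>n. c *\<^sub>R u n"]) blast
qed

instantiation lipfree :: ("{metric_space,zero}") real_vector
begin

lift_definition zero_lipfree :: "'a lipfree" is 0
  by (rule subspace_0[OF subspace_closure_span])

lift_definition plus_lipfree :: "'a lipfree \<Rightarrow> 'a lipfree \<Rightarrow> 'a lipfree" is "(+)"
  by (rule subspace_add[OF subspace_closure_span])

lift_definition minus_lipfree :: "'a lipfree \<Rightarrow> 'a lipfree \<Rightarrow> 'a lipfree" is "(-)"
  by (rule subspace_diff[OF subspace_closure_span])

lift_definition uminus_lipfree :: "'a lipfree \<Rightarrow> 'a lipfree" is uminus
  by (rule subspace_neg[OF subspace_closure_span])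

lift_definition scaleR_lipfree :: "real \<Rightarrow> 'a lipfree \<Rightarrow> 'a lipfree" is "(*\<^sub>R)"
  by (rule subspace_scale[OF subspace_closure_span])

instance
proof
  fix f g h :: "'a lipfree" and a b :: real
  show "f + g + h = f + (g + h)" by transfer (rule add.assoc)
  show "f + g = g + f" by transfer (rule add.commute)
  show "0 + f = f" by transfer simp
  show "- f + f = 0" by transfer simp
  show "f - g = f + - g" by transfer simp
  show "a *\<^sub>R (f + g) = a *\<^sub>R f + a *\<^sub>R g" by transfer (rule scaleR_add_right)
  show "(a + b) *\<^sub>R f = a *\<^sub>R f + b *\<^sub>R f" by transfer (rule scaleR_add_left)
  show "a *\<^sub>R b *\<^sub>R f = (a * b) *\<^sub>R f" by transfer simp
  show "1 *\<^sub>R f = f" by transfer simp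
qed

end

instantiation lipfree :: ("{metric_space,zero}") real_normed_vector
begin

lift_definition norm_lipfree :: "'a lipfree \<Rightarrow> real" is norm .

definition dist_lipfree :: "'a lipfree \<Rightarrow> 'a lipfree \<Rightarrow> real" where
  "dist_lipfree \<mu> \<nu> = norm (\<mu> - \<nu>)"

definition sgn_lipfree :: "'a lipfree \<Rightarrow> 'a lipfree" where
  "sgn_lipfree \<mu> = \<mu> /\<^sub>R norm \<mu>"

definition uniformity_lipfree :: "('a lipfree \<times> 'a lipfree) filter" where
  "uniformity_lipfree = (INF e\<in>{0<..}. principal {(\<mu>, \<nu>). dist \<mu> \<nu> < e})"

definition open_lipfree :: "'a lipfree set \<Rightarrow> bool" where
  "open_lipfree U = (\<forall>\<mu>\<in>U. eventually (\<lambda>(\<mu>', \<nu>). \<mu>' = \<mu> \<longrightarrow> \<nu> \<in> U) uniformity)"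

instance
proof
  fix f g :: "'a lipfree" and a :: real
  show "dist f g = norm (f - g)" by (rule dist_lipfree_def)
  show "sgn f = f /\<^sub>R norm f" by (rule sgn_lipfree_def)
  show "(uniformity :: ('a lipfree \<times> 'a lipfree) filter) = (INF e\<in>{0<..}. principal {(f, g). dist f g < e})"
    by (rule uniformity_lipfree_def)
  show "open U = (\<forall>f\<in>U. eventually (\<lambda>(f', g). f' = f \<longrightarrow> g \<in> U) uniformity)" for U :: "'a lipfree set"
    by (rule open_lipfree_def)
  show "norm f = 0 \<longleftrightarrow> f = 0" by transfer simp
  show "norm (f + g) \<le> norm f + norm g" by transfer (rule norm_triangle_ineq)
  show "norm (a *\<^sub>R f) = \<bar>a\<bar> * norm f" by transfer simp
qed

end

lift_definition lipfree_delta :: "'a::{metric_space,zero} \<Rightarrow> 'a lipfree" is lip0_eval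
  by (rule subsetD[OF closure_subset span_base[OF rangeI]])

lemma closure_span_lipfree_delta:
  "closure (span (range lipfree_delta)) = (UNIV :: 'a::{metric_space,zero} lipfree set)"
proof (intro equalityI subset_UNIV subsetI)
  fix \<mu> :: "'a lipfree"
  have lin: "linear (lipfree_functional :: 'a lipfree \<Rightarrow> _)"
    by (rule linearI) (simp_all add: plus_lipfree.rep_eq scaleR_lipfree.rep_eq)
  have img: "lipfree_functional ` span (range lipfree_delta) = span (range (lip0_eval :: 'a \<Rightarrow> _))"
    by (simp add: linear_span_image[OF lin, symmetric] image_image lipfree_delta.rep_eq)
  show "\<mu> \<in> closure (span (range lipfree_delta))"
    unfolding closure_approachable
  proof (intro allI impI)
    fix e :: real assume "e > 0"
    moreover have "lipfree_functional \<mu> \<in> closure (span (range lip0_eval))"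
      by (rule lipfree_functional)
    ultimately obtain \<nu> where "\<nu> \<in> span (range lipfree_delta)"
        "dist (lipfree_functional \<nu>) (lipfree_functional \<mu>) < e"
      unfolding closure_approachable img[symmetric] by blast
    moreover have "dist \<nu> \<mu> = dist (lipfree_functional \<nu>) (lipfree_functional \<mu>)"
      by (simp add: dist_norm norm_lipfree.rep_eq minus_lipfree.rep_eq)
    ultimately show "\<exists>y\<in>span (range lipfree_delta). dist y \<mu> < e"
      by (intro bexI[of _ \<nu>]) (simp_all only:)
  qed
qed


section \<open>The identification of \<open>Lip\<^sub>0(M)\<close> with the dual of the free space\<close>

lift_definition lip0_pairing :: "'a::{metric_space,zero} lip0 \<Rightarrow> 'a lipfree \<Rightarrow>\<^sub>L real"
  is "\<lambda>f \<mu>. blinfun_apply (lipfree_functional \<mu>) f"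
proof -
  fix f :: "'a lip0"
  show "bounded_linear (\<lambda>\<mu>. blinfun_apply (lipfree_functional \<mu>) f)"
  proof (rule bounded_linear_intro[of _ "norm f"])
    fix \<mu> :: "'a lipfree"
    show "norm (blinfun_apply (lipfree_functional \<mu>) f) \<le> norm \<mu> * norm f"
      unfolding norm_lipfree.rep_eq by (rule norm_blinfun)
  qed (auto simp: plus_lipfree.rep_eq scaleR_lipfree.rep_eq blinfun.add_left blinfun.scaleR_left)
qed

lemma lip0_pairing_delta [simp]:
  "blinfun_apply (lip0_pairing f) (lipfree_delta m) = lip0_apply f m"
  by (simp add: lip0_pairing.rep_eq lipfree_delta.rep_eq lip0_eval.rep_eq)

lemma linear_lip0_pairing: "linear lip0_pairing"
  by (rule linearI)
    (auto intro!: blinfun_eqI simp: lip0_pairing.rep_eq blinfun.bilinear_simps)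

lemma dist_lipfree_delta_le: "norm (lipfree_delta x - lipfree_delta y) \<le> dist x y"
proof -
  have "norm (lip0_eval x - lip0_eval y) \<le> dist x y"
    by (rule norm_blinfun_bound)
      (auto simp: blinfun.diff_left lip0_eval.rep_eq intro: order_trans[OF lip0_diff_le])
  then show ?thesis
    by (simp add: norm_lipfree.rep_eq minus_lipfree.rep_eq lipfree_delta.rep_eq)
qed

lemma norm_lip0_pairing: "norm (lip0_pairing f) = norm f"
proof (rule antisym)
  show "norm (lip0_pairing f) \<le> norm f"
  proof (rule norm_blinfun_bound)
    fix \<mu>
    show "norm (blinfun_apply (lip0_pairing f) \<mu>) \<le> norm f * norm \<mu>"
      using norm_blinfun[of "lipfree_functional \<mu>" f]
      by (simp add: lip0_pairing.rep_eq norm_lipfree.rep_eq mult.commute)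
  qed auto
  show "norm f \<le> norm (lip0_pairing f)"
  proof (rule norm_lip0_le)
    fix x y
    have "\<bar>lip0_apply f x - lip0_apply f y\<bar>
        = norm (blinfun_apply (lip0_pairing f) (lipfree_delta x - lipfree_delta y))"
      by (simp add: blinfun.diff_right)
    also have "\<dots> \<le> norm (lip0_pairing f) * norm (lipfree_delta x - lipfree_delta y)"
      by (rule norm_blinfun)
    also have "\<dots> \<le> norm (lip0_pairing f) * dist x y"
      by (intro mult_left_mono dist_lipfree_delta_le) auto
    finally show "\<bar>lip0_apply f x - lip0_apply f y\<bar> \<le> norm (lip0_pairing f) * dist x y" .
  qed auto
qed

lemma bij_lip0_pairing:
  "bij (lip0_pairing :: 'a::{metric_space,zero} lip0 \<Rightarrow> 'a lipfree \<Rightarrow>\<^sub>L real)"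
proof (rule bijI)
  show "inj (lip0_pairing :: 'a lip0 \<Rightarrow> _)"
    by (subst linear_injective_0[OF linear_lip0_pairing])
      (metis norm_eq_zero norm_lip0_pairing)
  show "surj (lip0_pairing :: 'a lip0 \<Rightarrow> _)"
    unfolding surj_def
  proof (intro allI)
    fix \<phi> :: "'a lipfree \<Rightarrow>\<^sub>L real"
    let ?f = "\<lambda>m. blinfun_apply \<phi> (lipfree_delta m)"
    have d0: "lipfree_delta (0 :: 'a) = 0"
      by transfer (auto intro!: blinfun_eqI simp: lip0_eval.rep_eq)
    have "(norm \<phi>)-lipschitz_on UNIV ?f"
    proof (rule lipschitz_onI)
      fix x y :: 'a
      have "dist (?f x) (?f y) = norm (blinfun_apply \<phi> (lipfree_delta x - lipfree_delta y))"
        by (simp add: dist_norm blinfun.diff_right)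
      also have "\<dots> \<le> norm \<phi> * norm (lipfree_delta x - lipfree_delta y)"
        by (rule norm_blinfun)
      also have "\<dots> \<le> norm \<phi> * dist x y"
        by (intro mult_left_mono dist_lipfree_delta_le) auto
      finally show "dist (?f x) (?f y) \<le> norm \<phi> * dist x y" .
    qed auto
    then have f: "lip0_apply (Lip0 ?f) m = ?f m" for m
      by (subst Lip0_inverse) (auto simp: d0)
    let ?Z = "{\<mu>. blinfun_apply (lip0_pairing (Lip0 ?f)) \<mu> = blinfun_apply \<phi> \<mu>}"
    have "span (range lipfree_delta) \<subseteq> ?Z"
      by (rule span_minimal)
        (auto simp: f subspace_def blinfun.add_right blinfun.scaleR_right)
    moreover have "closed ?Z"
      by (intro closed_Collect_eq continuous_intros)
    ultimately have "?Z = UNIV"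
      using closure_minimal closure_span_lipfree_delta by blast
    then show "\<exists>f. \<phi> = lip0_pairing f"
      by (intro exI[of _ "Lip0 ?f"] blinfun_eqI) (metis (mono_tags) UNIV_I mem_Collect_eq)
  qed
qed


section \<open>Cyclic sums\<close>

text \<open>For a list \<open>[i\<^sub>1, \<dots>, i\<^sub>m]\<close> this is
  \<open>d(x\<^sub>i\<^sub>1, y\<^sub>i\<^sub>2) + \<dots> + d(x\<^sub>i\<^sub>m\<^sub>-\<^sub>1, y\<^sub>i\<^sub>m) + d(x\<^sub>i\<^sub>m, y\<^sub>i\<^sub>1)\<close>; lists being indexed from \<open>0\<close>, the
  successor of the last position wraps around to \<open>0\<close>.\<close>

definition cyclic_dist_sum ::
    "(nat \<Rightarrow> 'a::metric_space) \<Rightarrow> (nat \<Rightarrow> 'a) \<Rightarrow> nat list \<Rightarrow> real" where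
  "cyclic_dist_sum x y is =
     (\<Sum>k<length is. dist (x (is ! k)) (y (is ! (Suc k mod length is))))"

end

theory Submission
  imports Defs
begin

text \<open>
  The equivalence of (1) and (2) is the classical duality between roughness and slices: a pair of
  functionals far apart in the slice of \<open>u\<close> makes \<open>norm (u + h) + norm (u - h) - 2\<close> large, and
  conversely functionals almost norming \<open>u + h\<close> and \<open>u - h\<close> lie in the slice and are far apart.

  From (3) to (2), cyclic monotonicity (b) yields a \<open>1\<close>-Lipschitz potential, so that the average of
  the molecules \<open>(\<delta>\<^sub>x - \<delta>\<^sub>y) / d(x, y)\<close> of the family has norm one. Functions in a small slice given
  by it are almost tight on every pair, hence by (a) almost tight along whole cycles, and differ by
  almost a constant on the points of the family; (c) carries this over to all of \<open>M\<close>, and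
  uniform discreteness turns a small oscillation into a small Lipschitz norm.

  From (2) to (3), the slicing element may be taken finitely supported. Let \<open>f0\<close> maximise it over the
  \<open>1\<close>-Lipschitz functions and let \<open>A\<close> be the set of pairs of support points on which \<open>f0\<close> is tight. By
  weak-star compactness, all functions almost tight on \<open>A\<close> lie in the slice, so they all agree with \<open>f0\<close>
  up to a small oscillation. Applied to a Rockafellar potential this gives short paths, hence (a);
  applied to the largest and smallest extensions of \<open>f0\<close> it gives (c).
\<close>

section \<open>Roughness and slices\<close>

lemma frequently_imp_le_Limsup:
  fixes q :: "'b \<Rightarrow> ereal"
  assumes "frequently (\<lambda>x. c \<le> q x) F"
  shows "c \<le> Limsup F q"
proof (rule Limsup_greatest)
  fix P assume "eventually P F"
  then have "eventually (\<lambda>x. c \<le> q x \<longrightarrow> c \<le> q x \<and> P x) F" by (auto elim: eventually_mono)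
  from this assms have "frequently (\<lambda>x. c \<le> q x \<and> P x) F" by (rule frequently_mp)
  then obtain x where "c \<le> q x" "P x" using frequently_ex by blast
  then show "c \<le> Sup (q ` Collect P)" by (auto intro: Sup_upper2)
qed

lemma frequently_less_if_less_Limsup:
  fixes q :: "'b \<Rightarrow> ereal"
  assumes "c < Limsup F q"
  shows "frequently (\<lambda>x. c < q x) F"
proof (rule ccontr)
  assume "\<not> ?thesis"
  then have "eventually (\<lambda>x. q x \<le> c) F" by (simp add: not_frequently not_less)
  then have "Limsup F q \<le> c" by (rule Limsup_bounded)
  with assms show False by simp
qed

lemma bounded_wstar_slice: "bounded (wstar_slice x \<alpha>)"
  by (rule bounded_subset[OF bounded_cball[of 0 1]]) (auto simp: wstar_slice_def)

text \<open>Some vector beats the factor \<open>c\<close>; by homogeneity it can be rescaled to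
  length \<open>t\<close> and given the right sign. The length is free because roughness is tested
  on arbitrarily short vectors.\<close>

lemma blinfun_less_norm_ex:
  fixes h :: "'x::real_normed_vector \<Rightarrow>\<^sub>L real"
  assumes "0 \<le> c" "c < norm h" "0 < t"
  obtains w where "norm w = t" "c * t < blinfun_apply h w"
proof -
  have "\<exists>w. \<not> norm (blinfun_apply h w) \<le> c * norm w"
    using norm_blinfun_bound[of c h] assms by force
  then obtain w where w: "c * norm w < \<bar>blinfun_apply h w\<bar>" by (auto simp: not_le)
  then have "w \<noteq> 0" by auto
  define r where "r = sgn (blinfun_apply h w) * (t / norm w)"
  have "blinfun_apply h w \<noteq> 0" using w assms(1) by (auto simp: mult_less_0_iff)
  then have "norm (r *\<^sub>R w) = t" using \<open>w \<noteq> 0\<close> assms by (simp add: r_def abs_mult abs_sgn_eq)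
  moreover have "blinfun_apply h (r *\<^sub>R w) = (t / norm w) * \<bar>blinfun_apply h w\<bar>"
    by (simp add: blinfun.scaleR_right r_def abs_sgn mult_ac)
  moreover have "c * t < (t / norm w) * \<bar>blinfun_apply h w\<bar>"
    using mult_strict_left_mono[OF w, of "t / norm w"] assms \<open>w \<noteq> 0\<close> by (simp add: mult_ac)
  ultimately show ?thesis using that by metis
qed

lemma rough_if_not_dual_wstar_BDP:
  assumes "\<not> dual_wstar_BDP TYPE('x::real_normed_vector)"
  shows "rough_norm TYPE('x)"
proof -
  obtain \<epsilon> where \<epsilon>: "\<epsilon> > 0"
    and diam: "\<And>(x::'x) \<alpha>. norm x = 1 \<Longrightarrow> \<alpha> > 0 \<Longrightarrow> \<epsilon> \<le> diameter (wstar_slice x \<alpha>)"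
    using assms unfolding dual_wstar_BDP_def by (force simp: not_less)
  have "eps_rough_norm (\<epsilon>/2) TYPE('x)"
    unfolding eps_rough_norm_def roughness_eta_def
  proof (intro allI impI frequently_imp_le_Limsup)
    fix u :: 'x assume u: "norm u = 1"
    show "\<exists>\<^sub>F h in at 0. ereal (\<epsilon>/2) \<le> ereal ((norm (u + h) + norm (u - h) - 2) / norm h)"
      unfolding frequently_at
    proof (intro allI impI)
      fix e :: real assume "e > 0"
      define t where "t = e/2"
      \<comment> \<open>The two slice conditions cost \<open>2 * \<alpha>\<close>, a quarter of
        \<open>\<epsilon> * t\<close>, which leaves \<open>\<epsilon>/2 * t\<close> of the
        \<open>3/4 * \<epsilon> * t\<close> gained along \<open>w\<close>.\<close>
      define \<alpha> where "\<alpha> = t * \<epsilon> / 8"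
      have t: "t > 0" and \<alpha>: "\<alpha> > 0" using \<open>e > 0\<close> \<epsilon> by (auto simp: t_def \<alpha>_def)
      have "3/4 * \<epsilon> < diameter (wstar_slice u \<alpha>)" using diam[OF u \<alpha>] \<epsilon> by simp
      then obtain f g where fg: "f \<in> wstar_slice u \<alpha>" "g \<in> wstar_slice u \<alpha>" "3/4 * \<epsilon> < dist f g"
        using diameter_lower_bounded[OF bounded_wstar_slice, of "3/4 * \<epsilon>" u \<alpha>] \<epsilon> by auto
      obtain w where w: "norm w = t" "3/4 * \<epsilon> * t < blinfun_apply (f - g) w"
        using blinfun_less_norm_ex[of "3/4*\<epsilon>" "f - g" t] fg(3) \<epsilon> t by (auto simp: dist_norm)
      have le: "blinfun_apply k v \<le> norm v" if "k \<in> wstar_slice u \<alpha>" for k v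
      proof -
        have "\<bar>blinfun_apply k v\<bar> \<le> norm k * norm v" using norm_blinfun[of k v] by simp
        also have "\<dots> \<le> 1 * norm v"
          using that by (intro mult_right_mono) (auto simp: wstar_slice_def)
        finally show ?thesis by simp
      qed
      have "blinfun_apply f (u + w) \<le> norm (u + w)" "blinfun_apply g (u - w) \<le> norm (u - w)"
        using le fg by auto
      moreover have "blinfun_apply f u > 1 - \<alpha>" "blinfun_apply g u > 1 - \<alpha>"
        using fg by (auto simp: wstar_slice_def)
      ultimately have "norm (u + w) + norm (u - w) - 2 \<ge> 3/4 * \<epsilon> * t - 2 * \<alpha>"
        using w(2) by (simp add: blinfun.bilinear_simps)
      also have "3/4 * \<epsilon> * t - 2 * \<alpha> = \<epsilon>/2 * t" by (simp add: \<alpha>_def)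
      finally have "\<epsilon>/2 \<le> (norm (u + w) + norm (u - w) - 2) / norm w"
        using t w(1) by (simp add: pos_le_divide_eq)
      moreover have "w \<noteq> 0" "dist w 0 < e" using w(1) t \<open>e > 0\<close> by (auto simp: t_def)
      ultimately show "\<exists>x\<in>UNIV. x \<noteq> 0 \<and> dist x 0 < e \<and>
          ereal (\<epsilon>/2) \<le> ereal ((norm (u + x) + norm (u - x) - 2) / norm x)"
        by (intro bexI[of _ w]) auto
    qed
  qed
  with \<epsilon> show ?thesis unfolding rough_norm_def by (metis half_gt_zero)
qed

text \<open>The hypothesis is a consequence of the Hahn-Banach theorem; for a free space it holds by
  construction.\<close>

lemma not_rough_if_dual_wstar_BDP:
  assumes norming: "\<And>(x::'x::real_normed_vector) c. c < norm x \<Longrightarrow> \<exists>f\<in>cball 0 1. c < blinfun_apply f x"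
    and "dual_wstar_BDP TYPE('x)"
  shows "\<not> rough_norm TYPE('x)"
proof
  assume "rough_norm TYPE('x)"
  then obtain \<epsilon> where \<epsilon>: "\<epsilon> > 0" "eps_rough_norm \<epsilon> TYPE('x)" unfolding rough_norm_def by blast
  obtain u :: 'x and \<alpha> where u: "norm u = 1" and \<alpha>: "\<alpha> > 0"
    and small: "diameter (wstar_slice u \<alpha>) < \<epsilon>/4"
    using assms(2)[unfolded dual_wstar_BDP_def, rule_format, of "\<epsilon>/4"] \<epsilon>(1) by auto
  have "ereal (\<epsilon>/2) < ereal \<epsilon>" using \<epsilon> by simp
  also have "ereal \<epsilon> \<le> Limsup (at 0) (\<lambda>h. ereal ((norm (u + h) + norm (u - h) - 2) / norm h))"
    using \<epsilon> u unfolding eps_rough_norm_def roughness_eta_def by blast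
  finally have "\<exists>\<^sub>F h in at 0. ereal (\<epsilon>/2) < ereal ((norm (u + h) + norm (u - h) - 2) / norm h)"
    by (rule frequently_less_if_less_Limsup)
  \<comment> \<open>For \<open>norm h < e\<close>, functionals norming \<open>u + h\<close> and
    \<open>u - h\<close> up to the error \<delta> chosen below lose at most
    \<open>2 * norm h + \<delta> < \<alpha>\<close> at \<open>u\<close>, so both lie in the
    slice.\<close>
  moreover define e where "e = \<alpha> / (2 + \<epsilon>)"
  have "e > 0" using \<alpha> \<epsilon> by (simp add: e_def)
  ultimately obtain h where h: "h \<noteq> 0" "norm h < e"
    "\<epsilon>/2 < (norm (u + h) + norm (u - h) - 2) / norm h"
    unfolding frequently_at by force
  \<comment> \<open>The error \<open>2 * \<delta>\<close> is a quarter of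
    \<open>\<epsilon> * norm h\<close>. Subtracted from the excess
    \<open>\<epsilon>/2 * norm h\<close>, it leaves \<open>\<epsilon>/4 * norm h\<close>, more than
    the diameter of the slice permits.\<close>
  define \<delta> where "\<delta> = \<epsilon>/8 * norm h"
  have hpos: "norm h > 0" and \<delta>: "\<delta> > 0" using h \<epsilon> by (auto simp: \<delta>_def)
  obtain f where f: "f \<in> cball 0 1" "norm (u + h) - \<delta> < blinfun_apply f (u + h)"
    using norming[of "norm (u + h) - \<delta>" "u + h"] \<delta> by auto
  obtain g where g: "g \<in> cball 0 1" "norm (u - h) - \<delta> < blinfun_apply g (u - h)"
    using norming[of "norm (u - h) - \<delta>" "u - h"] \<delta> by auto
  have le: "\<bar>blinfun_apply k v\<bar> \<le> norm v" if "k \<in> cball 0 1" for k :: "'x \<Rightarrow>\<^sub>L real" and v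
  proof -
    have "\<bar>blinfun_apply k v\<bar> \<le> norm k * norm v" using norm_blinfun[of k v] by simp
    also have "\<dots> \<le> 1 * norm v" using that by (intro mult_right_mono) auto
    finally show ?thesis by simp
  qed
  have tri: "1 - norm h \<le> norm (u + h)" "1 - norm h \<le> norm (u - h)"
    using norm_triangle_ineq2[of u "- h"] norm_triangle_ineq2[of u h] u by auto
  have "2 * norm h + \<delta> < \<alpha>"
  proof -
    have "2 * norm h + \<delta> \<le> (2 + \<epsilon>) * norm h" using hpos \<epsilon> by (simp add: \<delta>_def algebra_simps)
    also have "\<dots> < \<alpha>" using h(2) \<epsilon> by (simp add: e_def pos_less_divide_eq mult.commute)
    finally show ?thesis .
  qed
  then have "f \<in> wstar_slice u \<alpha>" "g \<in> wstar_slice u \<alpha>"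
    using f g tri le[OF f(1), of h] le[OF g(1), of h]
    by (auto simp: wstar_slice_def blinfun.bilinear_simps)
  then have "norm (f - g) < \<epsilon>/4"
    using diameter_bounded_bound[OF bounded_wstar_slice, of f u \<alpha> g] small by (simp add: dist_norm)
  moreover have "blinfun_apply (f - g) h \<le> norm (f - g) * norm h"
    using norm_blinfun[of "f - g" h] by simp
  ultimately have "blinfun_apply (f - g) h \<le> \<epsilon>/4 * norm h"
    using hpos by (meson less_eq_real_def mult_right_mono order_trans)
  moreover have "\<epsilon>/2 * norm h < norm (u + h) + norm (u - h) - 2"
    using h(3) hpos by (simp add: pos_less_divide_eq)
  moreover have "blinfun_apply f u \<le> 1" "blinfun_apply g u \<le> 1"
    using le[OF f(1), of u] le[OF g(1), of u] u by auto
  ultimately show False using f(2) g(2) by (simp add: blinfun.bilinear_simps \<delta>_def)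
qed

section \<open>Path sums and cyclic sums\<close>

fun path_sum :: "('i \<Rightarrow> 'i \<Rightarrow> real) \<Rightarrow> 'i list \<Rightarrow> real" where
  "path_sum w (a # b # l) = w a b + path_sum w (b # l)"
| "path_sum w l = 0"

text \<open>The weight is arbitrary rather than a distance, so that slacks
  \<open>w i j - (F i - G j)\<close> can be summed around the same cycle.\<close>

definition cyclic_sum :: "('i \<Rightarrow> 'i \<Rightarrow> real) \<Rightarrow> 'i list \<Rightarrow> real" where
  "cyclic_sum w l = (\<Sum>k<length l. w (l ! k) (l ! (Suc k mod length l)))"

lemma cyclic_dist_sum_eq: "cyclic_dist_sum x y = cyclic_sum (\<lambda>i j. dist (x i) (y j))"
  by (rule ext) (simp add: cyclic_dist_sum_def cyclic_sum_def)

lemma path_sum_eq_sum: "path_sum w l = (\<Sum>k<length l - 1. w (l ! k) (l ! Suc k))"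
proof (induction w l rule: path_sum.induct)
  case (1 w a b l)
  then show ?case by (simp add: sum.lessThan_Suc_shift del: sum.lessThan_Suc)
qed auto

lemma path_sum_append: "path_sum w (l @ a # l') = path_sum w (l @ [a]) + path_sum w (a # l')"
proof (induction l)
  case (Cons b l)
  then show ?case by (cases l) auto
qed simp

lemma path_sum_nonneg: "(\<And>i j. i \<in> set l \<Longrightarrow> j \<in> set l \<Longrightarrow> 0 \<le> w i j) \<Longrightarrow> 0 \<le> path_sum w l"
  by (induction w l rule: path_sum.induct) auto

lemma path_sum_map: "path_sum w (map h l) = path_sum (\<lambda>i j. w (h i) (h j)) l"
  by (simp add: path_sum_eq_sum)

lemma cyclic_sum_eq_path_sum: "l \<noteq> [] \<Longrightarrow> cyclic_sum w l = path_sum w l + w (last l) (hd l)"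
proof -
  assume "l \<noteq> []"
  then obtain m where m: "length l = Suc m" by (cases l) auto
  have "cyclic_sum w l = (\<Sum>k<m. w (l ! k) (l ! (Suc k mod Suc m))) + w (l ! m) (l ! 0)"
    by (simp add: cyclic_sum_def m)
  also have "(\<Sum>k<m. w (l ! k) (l ! (Suc k mod Suc m))) = path_sum w l"
    by (simp add: path_sum_eq_sum m)
  finally show ?thesis using \<open>l \<noteq> []\<close> by (simp add: last_conv_nth hd_conv_nth m)
qed

text \<open>Telescoping: each index gives \<open>F\<close> to the edge leaving it and
  \<open>G\<close> to the edge entering it; only \<open>F\<close> at the last and \<open>G\<close>
  at the first index remain unmatched.\<close>

lemma path_sum_slack:
  "l \<noteq> [] \<Longrightarrow> path_sum (\<lambda>i j. w i j - (F i - G j)) l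
    = path_sum w l - (\<Sum>i\<leftarrow>l. F i - G i) + F (last l) - G (hd l)"
  by (induction w l rule: path_sum.induct) auto

lemma path_sum_snoc: "l \<noteq> [] \<Longrightarrow> path_sum w (l @ [a]) = path_sum w l + w (last l) a"
  by (induction w l rule: path_sum.induct) auto

lemma cyclic_sum_Cons: "cyclic_sum w (a # l) = path_sum w ((a # l) @ [a])"
  by (subst path_sum_snoc) (simp_all add: cyclic_sum_eq_path_sum)

text \<open>The closing edge cancels the two boundary terms of the path. Hence (a) and (b) become
  statements about total slack: small for some cycles, nonnegative for all.\<close>

lemma cyclic_sum_slack:
  "cyclic_sum (\<lambda>i j. w i j - (F i - G j)) l = cyclic_sum w l - (\<Sum>i\<leftarrow>l. F i - G i)"
proof (cases "l = []")
  case False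
  then show ?thesis by (simp add: cyclic_sum_eq_path_sum path_sum_slack)
qed (simp add: cyclic_sum_def)

lemma cyclic_sum_mono:
  "(\<And>i j. i \<in> set l \<Longrightarrow> j \<in> set l \<Longrightarrow> v i j \<le> w i j) \<Longrightarrow> cyclic_sum v l \<le> cyclic_sum w l"
  unfolding cyclic_sum_def
  by (intro sum_mono) (metis lessThan_iff length_pos_if_in_set mod_less_divisor nth_mem)

lemma cyclic_sum_nonneg:
  "(\<And>i j. i \<in> set l \<Longrightarrow> j \<in> set l \<Longrightarrow> 0 \<le> w i j) \<Longrightarrow> 0 \<le> cyclic_sum w l"
  using cyclic_sum_mono[of l "\<lambda>_ _. 0" w] by (simp add: cyclic_sum_def)

lemma cyclic_sum_add:
  "cyclic_sum (\<lambda>i j. v i j + w i j) l = cyclic_sum v l + cyclic_sum w l"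
  by (simp add: cyclic_sum_def sum.distrib)

text \<open>Walking along the cycle from one position to the other telescopes \<open>H\<close>, so
  the total variation around the cycle bounds every difference.\<close>

lemma abs_diff_le_cyclic_sum:
  assumes "j \<in> set l" "k \<in> set l"
  shows "\<bar>H j - H k\<bar> \<le> cyclic_sum (\<lambda>i i'. \<bar>H i' - H i\<bar>) l"
proof -
  have *: "\<bar>H (l ! q) - H (l ! p)\<bar> \<le> cyclic_sum (\<lambda>i i'. \<bar>H i' - H i\<bar>) l"
    if "p \<le> q" "q < length l" for p q
  proof -
    have "H (l ! q) - H (l ! p) = (\<Sum>r=p..<q. H (l ! Suc r) - H (l ! r))"
      using sum_Suc_diff'[OF that(1), of "\<lambda>r. H (l ! r)"] by simp
    then have "\<bar>H (l ! q) - H (l ! p)\<bar> \<le> (\<Sum>r=p..<q. \<bar>H (l ! Suc r) - H (l ! r)\<bar>)"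
      by simp
    also have "\<dots> = (\<Sum>r=p..<q. \<bar>H (l ! (Suc r mod length l)) - H (l ! r)\<bar>)"
      using that by (intro sum.cong) auto
    also have "\<dots> \<le> cyclic_sum (\<lambda>i i'. \<bar>H i' - H i\<bar>) l"
      unfolding cyclic_sum_def using that by (intro sum_mono2) auto
    finally show ?thesis .
  qed
  obtain p q where "p < length l" "q < length l" "j = l ! p" "k = l ! q"
    using assms by (metis in_set_conv_nth)
  then show ?thesis using *[of p q] *[of q p] by (cases "p \<le> q") (auto simp: abs_minus_commute)
qed

text \<open>Cutting out the loop between two occurrences of the same entry removes a nonnegative sum
  and keeps both ends; induction on the length.\<close>

lemma loop_erasure:
  assumes "l \<noteq> []" and w: "\<And>i j. i \<in> set l \<Longrightarrow> j \<in> set l \<Longrightarrow> 0 \<le> w i j"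
  shows "\<exists>l'. l' \<noteq> [] \<and> distinct l' \<and> set l' \<subseteq> set l \<and> hd l' = hd l \<and> last l' = last l \<and>
    path_sum w l' \<le> path_sum w l"
  using assms
proof (induction l rule: length_induct)
  case (1 l)
  show ?case
  proof (cases "distinct l")
    case False
    then obtain xs ys zs y where l: "l = xs @ [y] @ ys @ [y] @ zs"
      using not_distinct_decomp by blast
    let ?l = "xs @ y # zs"
    have "0 \<le> path_sum w (y # ys @ [y])" by (rule path_sum_nonneg) (auto simp: 1 l)
    then have "path_sum w ?l \<le> path_sum w l"
      using path_sum_append[of w xs y zs] path_sum_append[of w xs y "ys @ y # zs"]
        path_sum_append[of w "y # ys" y zs] by (simp add: l)
    moreover have "hd ?l = hd l" "last ?l = last l" "set ?l \<subseteq> set l" "length ?l < length l"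
      by (auto simp: l hd_append)
    moreover have "\<exists>l'. l' \<noteq> [] \<and> distinct l' \<and> set l' \<subseteq> set ?l \<and> hd l' = hd ?l \<and>
        last l' = last ?l \<and> path_sum w l' \<le> path_sum w ?l"
      by (rule "1.IH"[rule_format]) (auto simp: 1 l)
    ultimately show ?thesis by (metis order_trans subset_trans)
  qed (use 1 in blast)
qed

lemma simple_path_form:
  assumes "l \<noteq> []" "hd l \<noteq> last l" "distinct l"
  obtains m where "l = hd l # m @ [last l]" "hd l \<notin> set m" "last l \<notin> set m" "distinct m"
proof -
  obtain a l1 where l: "l = a # l1" using assms by (cases l) auto
  with assms have "l1 \<noteq> []" by auto
  then obtain m b where "l1 = m @ [b]" by (metis append_butlast_last_id)
  with l assms that show ?thesis by auto
qed

section \<open>Lipschitz functions and the free space\<close>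

lemma lipschitz_on_1_real_iff:
  fixes f :: "'a::metric_space \<Rightarrow> real"
  shows "1-lipschitz_on UNIV f \<longleftrightarrow> (\<forall>x y. f x - f y \<le> dist x y)"
proof
  assume "1-lipschitz_on UNIV f"
  then have "\<bar>f x - f y\<bar> \<le> dist x y" for x y
    using lipschitz_onD[of 1 UNIV f x y] by (simp add: dist_real_def)
  then show "\<forall>x y. f x - f y \<le> dist x y" using abs_le_D1 by blast
next
  assume *: "\<forall>x y. f x - f y \<le> dist x y"
  have "\<bar>f x - f y\<bar> \<le> dist x y" for x y
    using *[rule_format, of x y] *[rule_format, of y x] by (simp add: abs_le_iff dist_commute)
  then show "1-lipschitz_on UNIV f" by (auto intro!: lipschitz_onI simp: dist_real_def)
qed

text \<open>An infimum of cones of slope one, finite because the heights are bounded below. The last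
  two conclusions characterise it as an infimum; it yields both the extension from a finite set and
  the potential over chains.\<close>

lemma inf_convolution_dist:
  fixes p :: "'i \<Rightarrow> 'a::metric_space"
  assumes "I \<noteq> {}" and bdd: "\<And>i. i \<in> I \<Longrightarrow> b \<le> \<phi> i"
  obtains g :: "'a \<Rightarrow> real" where "1-lipschitz_on UNIV g"
    "\<And>i z. i \<in> I \<Longrightarrow> g z \<le> \<phi> i + dist z (p i)"
    "\<And>c z. (\<And>i. i \<in> I \<Longrightarrow> c \<le> \<phi> i + dist z (p i)) \<Longrightarrow> c \<le> g z"
proof -
  define g where "g z = (INF i\<in>I. \<phi> i + dist z (p i))" for z
  have upper: "g z \<le> \<phi> i + dist z (p i)" if "i \<in> I" for i z
    unfolding g_def
    by (rule cINF_lower[OF _ that]) (auto intro!: bdd_belowI2[where m = b] simp: add_increasing2 bdd)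
  have lower: "c \<le> g z" if "\<And>i. i \<in> I \<Longrightarrow> c \<le> \<phi> i + dist z (p i)" for c z
    unfolding g_def using that \<open>I \<noteq> {}\<close> by (intro cINF_greatest) auto
  have "g x - g y \<le> dist x y" for x y
  proof -
    have "g x - dist x y \<le> g y"
    proof (rule lower)
      fix i assume "i \<in> I"
      then show "g x - dist x y \<le> \<phi> i + dist y (p i)"
        using upper[of i x] dist_triangle[of x "p i" y] by linarith
    qed
    then show ?thesis by simp
  qed
  then have "1-lipschitz_on UNIV g" by (simp add: lipschitz_on_1_real_iff)
  from that[OF this upper lower] show ?thesis .
qed

text \<open>This is the McShane extension. As \<open>P\<close> is finite, the infimum of the cones
  is attained, so each value \<open>g z\<close> is tied to a concrete point of
  \<open>P\<close>.\<close>

lemma lipschitz_extension_largest: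
  fixes f :: "'a::metric_space \<Rightarrow> real"
  assumes P: "finite P" "P \<noteq> {}" and f: "\<And>p q. p \<in> P \<Longrightarrow> q \<in> P \<Longrightarrow> f p - f q \<le> dist p q"
  obtains g where "1-lipschitz_on UNIV g" "\<And>p. p \<in> P \<Longrightarrow> g p = f p"
    "\<And>z. \<exists>p\<in>P. f p + dist z p \<le> g z"
proof -
  obtain g where g: "1-lipschitz_on UNIV g"
    "\<And>p z. p \<in> P \<Longrightarrow> g z \<le> f p + dist z p"
    "\<And>c z. (\<And>p. p \<in> P \<Longrightarrow> c \<le> f p + dist z p) \<Longrightarrow> c \<le> g z"
    using inf_convolution_dist[of P "Min (f ` P)" f "\<lambda>p. p"] P by auto
  have "g p = f p" if "p \<in> P" for p
  proof (rule antisym)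
    show "g p \<le> f p" using g(2)[OF that, of p] by simp
    show "f p \<le> g p" by (rule g(3)) (use f that in \<open>force simp: algebra_simps\<close>)
  qed
  moreover have "\<exists>p\<in>P. f p + dist z p \<le> g z" for z
  proof -
    let ?m = "Min ((\<lambda>p. f p + dist z p) ` P)"
    have "?m \<in> (\<lambda>p. f p + dist z p) ` P" using P by (intro Min_in) auto
    then obtain p where "p \<in> P" "?m = f p + dist z p" by auto
    moreover have "?m \<le> g z" by (rule g(3)) (use P in auto)
    ultimately show ?thesis by auto
  qed
  ultimately show ?thesis using that g(1) by blast
qed

lemma lipschitz_extension_smallest:
  fixes f :: "'a::metric_space \<Rightarrow> real"
  assumes P: "finite P" "P \<noteq> {}" and f: "\<And>p q. p \<in> P \<Longrightarrow> q \<in> P \<Longrightarrow> f p - f q \<le> dist p q"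
  obtains g where "1-lipschitz_on UNIV g" "\<And>p. p \<in> P \<Longrightarrow> g p = f p"
    "\<And>z. \<exists>p\<in>P. g z \<le> f p - dist z p"
proof -
  have "- f p - - f q \<le> dist p q" if "p \<in> P" "q \<in> P" for p q
    using f[OF that(2,1)] by (simp add: dist_commute)
  then obtain g where g: "1-lipschitz_on UNIV g" "\<And>p. p \<in> P \<Longrightarrow> g p = - f p"
    "\<And>z. \<exists>p\<in>P. - f p + dist z p \<le> g z"
    using lipschitz_extension_largest[OF P, of "\<lambda>p. - f p"] by blast
  show ?thesis
  proof (rule that[of "\<lambda>z. - g z"])
    show "1-lipschitz_on UNIV (\<lambda>z. - g z)" using g(1) by simp
    show "\<exists>p\<in>P. - g z \<le> f p - dist z p" for z using g(3)[of z] by force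
  qed (use g in auto)
qed

text \<open>Rockafellar's potential of a cyclically monotone family, as an infimum over chains. Chains
  may be restricted to a class closed under prepending, e.g. those with a prescribed last index.\<close>

lemma cyclically_monotone_potential:
  fixes x y :: "'i \<Rightarrow> 'a::metric_space"
  defines "\<phi> l \<equiv> path_sum (\<lambda>i j. dist (x i) (y j)) l - (\<Sum>i\<leftarrow>l. dist (x i) (y i))"
  assumes "finite I"
    and mono: "\<And>l. l \<noteq> [] \<Longrightarrow> set l \<subseteq> I \<Longrightarrow>
      (\<Sum>i\<leftarrow>l. dist (x i) (y i)) \<le> cyclic_sum (\<lambda>i j. dist (x i) (y j)) l"
    and C: "C \<noteq> {}" "\<And>l. l \<in> C \<Longrightarrow> l \<noteq> [] \<and> set l \<subseteq> I" "\<And>i l. i \<in> I \<Longrightarrow> l \<in> C \<Longrightarrow> i # l \<in> C"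
  obtains f :: "'a \<Rightarrow> real" where "1-lipschitz_on UNIV f"
    "\<And>i. i \<in> I \<Longrightarrow> f (x i) - f (y i) = dist (x i) (y i)"
    "\<And>l z. l \<in> C \<Longrightarrow> f z \<le> \<phi> l + dist z (y (hd l))"
    "\<And>c z. (\<And>l. l \<in> C \<Longrightarrow> c \<le> \<phi> l + dist z (y (hd l))) \<Longrightarrow> c \<le> f z"
proof -
  define B where "B = Max ((\<lambda>(i, j). dist (x i) (y j)) ` (I \<times> I))"
  \<comment> \<open>The edge from the last to the first index closes the chain to a cycle; cyclic
    monotonicity then bounds the cost of the chain below by minus that edge.\<close>
  have bdd: "- B \<le> \<phi> l" if "l \<in> C" for l
  proof -
    have l: "l \<noteq> []" "set l \<subseteq> I" using C(2)[OF that] by auto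
    then have "last l \<in> I" "hd l \<in> I" by auto
    then have "dist (x (last l)) (y (hd l)) \<le> B"
      unfolding B_def using \<open>finite I\<close> by (intro Max_ge) auto
    with mono[OF l] show ?thesis by (simp add: cyclic_sum_eq_path_sum[OF l(1)] \<phi>_def)
  qed
  obtain f where f: "1-lipschitz_on UNIV f"
    "\<And>l z. l \<in> C \<Longrightarrow> f z \<le> \<phi> l + dist z (y (hd l))"
    "\<And>c z. (\<And>l. l \<in> C \<Longrightarrow> c \<le> \<phi> l + dist z (y (hd l))) \<Longrightarrow> c \<le> f z"
    using inf_convolution_dist[of C "- B" \<phi> "\<lambda>l. y (hd l)"] C(1) bdd by blast
  have "f (x i) - f (y i) = dist (x i) (y i)" if i: "i \<in> I" for i
  proof (rule antisym)
    show "f (x i) - f (y i) \<le> dist (x i) (y i)" using f(1) by (simp add: lipschitz_on_1_real_iff)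
    \<comment> \<open>Prepending \<open>i\<close> to a chain is what makes the pair tight: evaluated
      at \<open>y i\<close>, the longer chain is cheaper by \<open>dist (x i) (y i)\<close> than the
      original chain evaluated at \<open>x i\<close>.\<close>
    have "f (y i) + dist (x i) (y i) \<le> f (x i)"
    proof (rule f(3))
      fix l assume l: "l \<in> C"
      then obtain j l' where jl: "l = j # l'" using C(2) by (cases l) auto
      show "f (y i) + dist (x i) (y i) \<le> \<phi> l + dist (x i) (y (hd l))"
        using f(2)[OF C(3)[OF i l], of "y i"] by (simp add: \<phi>_def jl)
    qed
    then show "dist (x i) (y i) \<le> f (x i) - f (y i)" by simp
  qed
  from that[OF f(1) this f(2,3)] show ?thesis .
qed

text \<open>The slacks of each function around the cycle are nonnegative and sum to at most
  \<open>2 * \<epsilon>\<close>: one \<epsilon> from the cycle condition, one from the defects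
  \<tau> on the pairs. So both functions grow almost alike along every edge; \<tau> per edge adds
  the fifth \<epsilon>.\<close>

lemma cycle_oscillation:
  fixes f g :: "'a::metric_space \<Rightarrow> real" and \<tau> \<epsilon> :: real
  assumes f: "1-lipschitz_on UNIV f" "\<And>i. i \<in> I \<Longrightarrow> dist (x i) (y i) - \<tau> \<le> f (x i) - f (y i)"
    and g: "1-lipschitz_on UNIV g" "\<And>i. i \<in> I \<Longrightarrow> dist (x i) (y i) - \<tau> \<le> g (x i) - g (y i)"
    and I: "finite I" "card I * \<tau> \<le> \<epsilon>" "0 \<le> \<tau>"
    and l: "distinct l" "set l \<subseteq> I"
    and cyc: "cyclic_sum (\<lambda>i j. dist (x i) (y j)) l - \<epsilon> < (\<Sum>i\<leftarrow>l. dist (x i) (y i))"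
    and jk: "j \<in> set l" "k \<in> set l"
  shows "\<bar>(f (x j) - g (x j)) - (f (x k) - g (x k))\<bar> \<le> 5 * \<epsilon>"
proof -
  define a where "a F = (\<lambda>i j. dist (x i) (y j) - (F (x i) - F (y j)))" for F :: "'a \<Rightarrow> real"
  have "length l \<le> card I" using l I card_mono distinct_card by metis
  then have len: "length l * \<tau> \<le> \<epsilon>" using I by (meson mult_right_mono of_nat_mono order_trans)
  have cyc_a: "cyclic_sum (a F) l \<le> 2 * \<epsilon>"
    if "\<And>i. i \<in> I \<Longrightarrow> dist (x i) (y i) - \<tau> \<le> F (x i) - F (y i)" for F
  proof -
    have "(\<Sum>i\<leftarrow>l. dist (x i) (y i)) - (\<Sum>i\<leftarrow>l. F (x i) - F (y i))
        = (\<Sum>i\<leftarrow>l. dist (x i) (y i) - (F (x i) - F (y i)))"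
      by (simp add: sum_list_subtractf)
    also have "\<dots> \<le> (\<Sum>i\<leftarrow>l. \<tau>)" using that l by (intro sum_list_mono) force
    also have "\<dots> \<le> \<epsilon>" using len by (simp add: sum_list_triv)
    finally show ?thesis using cyc by (simp add: a_def cyclic_sum_slack)
  qed
  have nonneg: "0 \<le> a F i i'" if "1-lipschitz_on UNIV F" for F i i'
    using that by (simp add: a_def lipschitz_on_1_real_iff)
  define H where "H i = f (x i) - g (x i)" for i
  have "\<bar>H j - H k\<bar> \<le> cyclic_sum (\<lambda>i i'. \<bar>H i' - H i\<bar>) l"
    using jk by (rule abs_diff_le_cyclic_sum)
  \<comment> \<open>The step from \<open>x i\<close> to \<open>x i'\<close> passes through
    \<open>y i'\<close>: the slacks control the edge from \<open>x i\<close> to \<open>y i'\<close>,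
    and \<tau> controls the pair of \<open>i'\<close>.\<close>
  also have "\<dots> \<le> cyclic_sum (\<lambda>i i'. a f i i' + (a g i i' + \<tau>)) l"
  proof (rule cyclic_sum_mono)
    fix i i' assume "i \<in> set l" "i' \<in> set l"
    then have "i' \<in> I" using l by auto
    then show "\<bar>H i' - H i\<bar> \<le> a f i i' + (a g i i' + \<tau>)"
      using f(2)[of i'] g(2)[of i'] nonneg[OF f(1), of i' i'] nonneg[OF g(1), of i' i']
        nonneg[OF f(1), of i i'] nonneg[OF g(1), of i i'] unfolding a_def H_def by linarith
  qed
  also have "\<dots> = cyclic_sum (a f) l + (cyclic_sum (a g) l + length l * \<tau>)"
    by (simp add: cyclic_sum_add) (simp add: cyclic_sum_def)
  also have "\<dots> \<le> 5 * \<epsilon>" using cyc_a[OF f(2)] cyc_a[OF g(2)] len by simp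
  finally show ?thesis by (simp add: H_def)
qed

section \<open>Lipschitz functions as functionals on the free space\<close>

lemma lip0_norm_le_1_iff: "norm f \<le> 1 \<longleftrightarrow> 1-lipschitz_on UNIV (lip0_apply f)"
proof
  assume n: "norm f \<le> 1"
  have "\<bar>lip0_apply f x - lip0_apply f y\<bar> \<le> dist x y" for x y
    using lip0_diff_le[of f x y] mult_right_mono[OF n, of "dist x y"] by simp
  then show "1-lipschitz_on UNIV (lip0_apply f)"
    unfolding lipschitz_on_1_real_iff using abs_le_D1 by blast
next
  assume "1-lipschitz_on UNIV (lip0_apply f)"
  then show "norm f \<le> 1"
    using lipschitz_onD[of 1 UNIV "lip0_apply f"] by (intro norm_lip0_le) (auto simp: dist_real_def)
qed

lemma lip0_of_lipschitz:
  fixes F :: "'a::{metric_space,zero} \<Rightarrow> real"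
  assumes "1-lipschitz_on UNIV F"
  obtains f where "norm f \<le> 1" "\<And>x. lip0_apply f x = F x - F 0"
proof -
  have lip: "1-lipschitz_on UNIV (\<lambda>x. F x - F 0)" using assms by (simp add: lipschitz_on_1_real_iff)
  then have "lip0_apply (Lip0 (\<lambda>x. F x - F 0)) = (\<lambda>x. F x - F 0)"
    by (intro Lip0_inverse) auto
  then show ?thesis using that[of "Lip0 (\<lambda>x. F x - F 0)"] lip by (simp add: lip0_norm_le_1_iff)
qed

lemma abs_lip0_pairing_le: "\<bar>blinfun_apply (lip0_pairing f) \<mu>\<bar> \<le> norm f * norm \<mu>"
  using norm_blinfun[of "lip0_pairing f" \<mu>] by (simp add: norm_lip0_pairing)

text \<open>An element of the free space is a functional on \<open>lip0\<close>, so its norm is by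
  construction approached on the unit ball of \<open>lip0\<close>.\<close>

lemma lipfree_norming:
  fixes \<mu> :: "'a::{metric_space,zero} lipfree"
  assumes "c < norm \<mu>"
  shows "\<exists>f. norm f \<le> 1 \<and> c < blinfun_apply (lip0_pairing f) \<mu>"
proof (cases "c < 0")
  case True
  then show ?thesis by (intro exI[of _ 0]) (simp add: linear_0[OF linear_lip0_pairing])
next
  case False
  then obtain w where "norm w = 1" "c < blinfun_apply (lipfree_functional \<mu>) w"
    using blinfun_less_norm_ex[of c "lipfree_functional \<mu>" 1] assms by (auto simp: norm_lipfree.rep_eq)
  then show ?thesis by (intro exI[of _ w]) (simp add: lip0_pairing.rep_eq)
qed

lemma lipfree_norming_dual:
  "c < norm \<mu> \<Longrightarrow> \<exists>\<phi>\<in>cball 0 1. c < blinfun_apply \<phi> (\<mu> :: 'a::{metric_space,zero} lipfree)"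
  using lipfree_norming[of c \<mu>] by (auto simp: norm_lip0_pairing)

lemma wstar_slice_lipfree:
  "wstar_slice (\<mu> :: 'a::{metric_space,zero} lipfree) \<alpha> =
    lip0_pairing ` {f. norm f \<le> 1 \<and> 1 - \<alpha> < blinfun_apply (lip0_pairing f) \<mu>}"
proof (intro equalityI subsetI)
  fix \<phi> assume \<phi>: "\<phi> \<in> wstar_slice \<mu> \<alpha>"
  obtain f where "\<phi> = lip0_pairing f" using bij_lip0_pairing by (metis bij_pointE)
  with \<phi> show "\<phi> \<in> lip0_pairing ` {f. norm f \<le> 1 \<and> 1 - \<alpha> < blinfun_apply (lip0_pairing f) \<mu>}"
    by (auto simp: wstar_slice_def norm_lip0_pairing)
qed (auto simp: wstar_slice_def norm_lip0_pairing)

lemma dist_lip0_pairing: "dist (lip0_pairing f) (lip0_pairing g) = norm (f - g)"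
  by (simp add: dist_norm flip: linear_diff[OF linear_lip0_pairing] norm_lip0_pairing)

section \<open>From the metric condition to small slices\<close>

text \<open>The element is the average of the normalised molecules of the pairs. Each pairs to at
  most one with the unit ball and \<open>f0\<close> attains one on all of them, so the norm is
  one.\<close>

lemma near_norming_wstar_slice:
  fixes x y :: "'i \<Rightarrow> 'a::{metric_space,zero}"
  assumes I: "finite I" "I \<noteq> {}" and ne: "\<And>i. i \<in> I \<Longrightarrow> x i \<noteq> y i"
    and f0: "1-lipschitz_on UNIV f0" "\<And>i. i \<in> I \<Longrightarrow> f0 (x i) - f0 (y i) = dist (x i) (y i)"
  obtains \<mu> :: "'a lipfree" where "norm \<mu> = 1"
    "\<And>f \<alpha> i. norm f \<le> 1 \<Longrightarrow> 1 - \<alpha> / card I < blinfun_apply (lip0_pairing f) \<mu> \<Longrightarrow> i \<in> I \<Longrightarrow>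
      dist (x i) (y i) * (1 - \<alpha>) < lip0_apply f (x i) - lip0_apply f (y i)"
proof -
  define q where "q f i = (lip0_apply f (x i) - lip0_apply f (y i)) / dist (x i) (y i)" for f i
  define \<mu> where "\<mu> = (\<Sum>i\<in>I. (1 / (card I * dist (x i) (y i))) *\<^sub>R (lipfree_delta (x i) - lipfree_delta (y i)))"
  have card: "real (card I) > 0" using I by (simp add: card_gt_0_iff)
  have pairing: "blinfun_apply (lip0_pairing f) \<mu> = (\<Sum>i\<in>I. q f i) / card I" for f
    by (simp add: \<mu>_def q_def blinfun.sum_right blinfun.scaleR_right blinfun.diff_right sum_divide_distrib mult.commute)
  have q_le: "q f i \<le> 1" if "norm f \<le> 1" "i \<in> I" for f i
    using that ne[of i] by (simp add: q_def lip0_norm_le_1_iff lipschitz_on_1_real_iff)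
  have "norm \<mu> = 1"
  proof (rule antisym)
    have "norm \<mu> \<le> (\<Sum>i\<in>I. 1 / card I)"
      unfolding \<mu>_def
    proof (rule sum_norm_le)
      fix i assume "i \<in> I"
      then show "norm ((1 / (card I * dist (x i) (y i))) *\<^sub>R (lipfree_delta (x i) - lipfree_delta (y i))) \<le> 1 / card I"
        using dist_lipfree_delta_le[of "x i" "y i"] ne[of i] card
        by (simp add: divide_simps)
    qed
    then show "norm \<mu> \<le> 1" using card by simp
    obtain f where f: "norm f \<le> 1" "\<And>x. lip0_apply f x = f0 x - f0 0"
      using lip0_of_lipschitz[OF f0(1)] by blast
    have "(\<Sum>i\<in>I. q f i) = card I" using ne f0(2) by (simp add: q_def f(2))
    then have "blinfun_apply (lip0_pairing f) \<mu> = 1" using card by (simp add: pairing)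
    then have "1 \<le> norm f * norm \<mu>" using abs_lip0_pairing_le[of f \<mu>] by simp
    also have "\<dots> \<le> 1 * norm \<mu>" using f(1) by (intro mult_right_mono) auto
    finally show "1 \<le> norm \<mu>" by simp
  qed
  moreover have "dist (x i) (y i) * (1 - \<alpha>) < lip0_apply f (x i) - lip0_apply f (y i)"
    if "norm f \<le> 1" "1 - \<alpha> / card I < blinfun_apply (lip0_pairing f) \<mu>" "i \<in> I" for f \<alpha> i
  proof -
    \<comment> \<open>An average of \<open>card I\<close> numbers, all at most one, that exceeds
      \<open>1 - \<alpha> / card I\<close> forces each of them above
      \<open>1 - \<alpha>\<close>.\<close>
    have "card I - \<alpha> = (1 - \<alpha> / card I) * card I" using card by (simp add: field_simps)
    also have "\<dots> < (\<Sum>j\<in>I. q f j)"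
      using that(2) card by (simp add: pairing pos_less_divide_eq)
    also have "\<dots> = q f i + (\<Sum>j\<in>I-{i}. q f j)" using I(1) that(3) by (rule sum.remove)
    also have "\<dots> \<le> q f i + (\<Sum>j\<in>I-{i}. 1)" using q_le[OF that(1)] by (intro add_left_mono sum_mono) auto
    also have "\<dots> = q f i + (real (card I) - 1)" using I that(3) by (simp add: card_Diff_singleton of_nat_diff Suc_le_eq card_gt_0_iff)
    finally have "1 - \<alpha> < q f i" by simp
    then show ?thesis using ne[OF that(3)] by (simp add: q_def pos_less_divide_eq mult.commute)
  qed
  ultimately show ?thesis using that by blast
qed

text \<open>The metric condition for fixed parameters, worded exactly as in the theorem so that
  unfolding yields its third statement.\<close>

definition small_slice_family ::
    "real \<Rightarrow> real \<Rightarrow> nat \<Rightarrow> (nat \<Rightarrow> 'a::metric_space) \<Rightarrow> (nat \<Rightarrow> 'a) \<Rightarrow> bool" where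
  "small_slice_family \<epsilon> \<alpha> n x y \<longleftrightarrow>
     (\<forall>i\<in>{1..n}. x i \<noteq> y i) \<and>
     (\<forall>j\<in>{1..n}. \<forall>k\<in>{1..n}. j \<noteq> k \<longrightarrow>
        (\<exists>is. distinct is \<and> set is \<subseteq> {1..n} \<and> j \<in> set is \<and> k \<in> set is \<and>
           cyclic_dist_sum x y is - \<epsilon> < (\<Sum>i\<leftarrow>is. dist (x i) (y i)))) \<and>
     (\<forall>is. is \<noteq> [] \<and> set is \<subseteq> {1..n} \<longrightarrow>
        (\<Sum>i\<leftarrow>is. dist (x i) (y i)) \<le> cyclic_dist_sum x y is) \<and>
     (\<forall>z. \<exists>s\<in>x ` {1..n} \<union> y ` {1..n}. \<exists>t\<in>x ` {1..n} \<union> y ` {1..n}.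
        s \<noteq> t \<and> dist z s + dist z t < dist s t + \<epsilon> \<and>
        (\<forall>f :: 'a \<Rightarrow> real. 1-lipschitz_on UNIV f \<and>
            (\<forall>i\<in>{1..n}. f (x i) - f (y i) > dist (x i) (y i) * (1 - \<alpha>)) \<longrightarrow>
            f t - f s > dist s t - \<epsilon>))"

lemma dual_wstar_BDP_if_small_slice_family:
  assumes \<theta>: "\<theta> > 0" "\<And>x y :: 'a::{metric_space,zero}. x \<noteq> y \<Longrightarrow> \<theta> \<le> dist x y"
    and D: "D > 0" "\<And>x y :: 'a. dist x y \<le> D"
    and fam: "\<And>\<epsilon>. \<epsilon> > 0 \<Longrightarrow> \<exists>\<alpha>>0. \<exists>n\<ge>1. \<exists>(x :: nat \<Rightarrow> 'a) y. small_slice_family \<epsilon> \<alpha> n x y"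
  shows "dual_wstar_BDP TYPE('a lipfree)"
  unfolding dual_wstar_BDP_def
proof (intro allI impI)
  fix \<epsilon>0 :: real assume \<epsilon>0: "\<epsilon>0 > 0"
  \<comment> \<open>Functions in the slice will differ by oscillation at most
    \<open>11 * \<epsilon>\<close>, hence by norm at most \<open>11 * \<epsilon> / \<theta>\<close>,
    which is below \<open>\<epsilon>0\<close>.\<close>
  define \<epsilon> where "\<epsilon> = \<epsilon>0 * \<theta> / 24"
  have \<epsilon>: "\<epsilon> > 0" using \<epsilon>0 \<theta> by (simp add: \<epsilon>_def)
  obtain \<alpha> n and x y :: "nat \<Rightarrow> 'a" where \<alpha>: "\<alpha> > 0" and n: "n \<ge> 1" and xy: "small_slice_family \<epsilon> \<alpha> n x y"
    using fam[OF \<epsilon>] by blast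
  define I where "I = {1..n}"
  have I: "finite I" "I \<noteq> {}" "card I = n" using n by (auto simp: I_def)
  note xy = xy[unfolded small_slice_family_def cyclic_dist_sum_eq, folded I_def]
  define Q where "Q = x ` I \<union> y ` I"
  have ne: "\<And>i. i \<in> I \<Longrightarrow> x i \<noteq> y i"
    and mono: "\<And>l. l \<noteq> [] \<Longrightarrow> set l \<subseteq> I \<Longrightarrow>
      (\<Sum>i\<leftarrow>l. dist (x i) (y i)) \<le> cyclic_sum (\<lambda>i j. dist (x i) (y j)) l"
    using xy by blast+
  have determined: "\<forall>z. \<exists>s\<in>Q. \<exists>t\<in>Q. s \<noteq> t \<and> dist z s + dist z t < dist s t + \<epsilon> \<and>
      (\<forall>f :: 'a \<Rightarrow> real. 1-lipschitz_on UNIV f \<and>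
        (\<forall>i\<in>I. f (x i) - f (y i) > dist (x i) (y i) * (1 - \<alpha>)) \<longrightarrow> f t - f s > dist s t - \<epsilon>)"
    using xy unfolding Q_def by (elim conjE)
  define C where "C = {l. l \<noteq> [] \<and> set l \<subseteq> I}"
  obtain i where "i \<in> I" using I(2) by blast
  then have "[i] \<in> C" by (simp add: C_def)
  then have "C \<noteq> {}" by blast
  then have C: "C \<noteq> {}" "\<And>l. l \<in> C \<Longrightarrow> l \<noteq> [] \<and> set l \<subseteq> I"
    "\<And>i l. i \<in> I \<Longrightarrow> l \<in> C \<Longrightarrow> i # l \<in> C"
    by (auto simp: C_def)
  obtain f0 :: "'a \<Rightarrow> real" where f0: "1-lipschitz_on UNIV f0"
    "\<And>i. i \<in> I \<Longrightarrow> f0 (x i) - f0 (y i) = dist (x i) (y i)"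
  proof (rule cyclically_monotone_potential[OF I(1) mono C])
    fix f :: "'a \<Rightarrow> real"
    assume "1-lipschitz_on UNIV f" "\<And>i. i \<in> I \<Longrightarrow> f (x i) - f (y i) = dist (x i) (y i)"
    then show thesis by (rule that)
  qed
  obtain \<mu> :: "'a lipfree" where \<mu>: "norm \<mu> = 1"
    "\<And>f \<alpha> i. norm f \<le> 1 \<Longrightarrow> 1 - \<alpha> / card I < blinfun_apply (lip0_pairing f) \<mu> \<Longrightarrow> i \<in> I \<Longrightarrow>
      dist (x i) (y i) * (1 - \<alpha>) < lip0_apply f (x i) - lip0_apply f (y i)"
    using near_norming_wstar_slice[of I x y f0] I(1,2) ne f0 by blast
  \<comment> \<open>The bound by \<alpha> makes the determination in (c) applicable; the other bound
    keeps the total defect of all \<open>n\<close> pairs below \<epsilon>.\<close>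
  define \<beta> where "\<beta> = min \<alpha> (\<epsilon> / (n * D))"
  have \<beta>: "\<beta> > 0" "\<beta> \<le> \<alpha>" using \<alpha> \<epsilon> n D by (auto simp: \<beta>_def)
  have "\<beta> \<le> \<epsilon> / (n * D)" by (simp add: \<beta>_def)
  then have n\<beta>: "n * (\<beta> * D) \<le> \<epsilon>" using n D by (simp add: pos_le_divide_eq mult_ac)
  moreover have "1 * (\<beta> * D) \<le> n * (\<beta> * D)" using n \<beta> D by (intro mult_right_mono) auto
  ultimately have \<beta>D: "\<beta> * D \<le> \<epsilon>" by simp
  have "norm (f - g) \<le> 11 * \<epsilon> / \<theta>"
    if f: "norm f \<le> 1" "1 - \<beta> / card I < blinfun_apply (lip0_pairing f) \<mu>"
      and g: "norm g \<le> 1" "1 - \<beta> / card I < blinfun_apply (lip0_pairing g) \<mu>" for f g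
  proof -
    define h where "h z = lip0_apply f z - lip0_apply g z" for z
    have lip: "1-lipschitz_on UNIV (lip0_apply f)" "1-lipschitz_on UNIV (lip0_apply g)"
      using f g by (auto simp: lip0_norm_le_1_iff)
    have up: "lip0_apply k p - lip0_apply k q \<le> dist p q" if "norm k \<le> 1" for k :: "'a lip0" and p q
      using that by (simp add: lip0_norm_le_1_iff lipschitz_on_1_real_iff)
    have tight: "dist (x i) (y i) - \<beta> * D \<le> lip0_apply k (x i) - lip0_apply k (y i)"
      and near: "dist (x i) (y i) * (1 - \<alpha>) < lip0_apply k (x i) - lip0_apply k (y i)"
      if "norm k \<le> 1" "1 - \<beta> / card I < blinfun_apply (lip0_pairing k) \<mu>" "i \<in> I" for k i
    proof -
      have *: "dist (x i) (y i) * (1 - \<beta>) < lip0_apply k (x i) - lip0_apply k (y i)"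
        using \<mu>(2)[OF that] .
      moreover have "\<beta> * dist (x i) (y i) \<le> \<beta> * D" "\<beta> * dist (x i) (y i) \<le> \<alpha> * dist (x i) (y i)"
        using \<beta> D by (auto intro: mult_left_mono mult_right_mono)
      ultimately show "dist (x i) (y i) - \<beta> * D \<le> lip0_apply k (x i) - lip0_apply k (y i)"
        "dist (x i) (y i) * (1 - \<alpha>) < lip0_apply k (x i) - lip0_apply k (y i)"
        by (auto simp: algebra_simps)
    qed
    have hx: "\<bar>h (x j) - h (x k)\<bar> \<le> 5 * \<epsilon>" if jk: "j \<in> I" "k \<in> I" for j k
    proof (cases "j = k")
      case False
      then obtain l where l: "distinct l" "set l \<subseteq> I" "j \<in> set l" "k \<in> set l"
        "cyclic_sum (\<lambda>i j. dist (x i) (y j)) l - \<epsilon> < (\<Sum>i\<leftarrow>l. dist (x i) (y i))"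
        using xy jk by blast
      show ?thesis unfolding h_def
        by (rule cycle_oscillation[OF lip(1) tight[OF f] lip(2) tight[OF g] I(1) _ _ l(1,2,5,3,4)])
          (use n\<beta> I \<beta> D in auto)
    qed (use \<epsilon> in simp)
    have hxy: "\<bar>h (x i) - h (y i)\<bar> \<le> \<epsilon>" if "i \<in> I" for i
      using tight[OF f that] tight[OF g that] up[OF f(1), of "x i" "y i"] up[OF g(1), of "x i" "y i"] \<beta>D
      unfolding h_def by linarith
    \<comment> \<open>Each family point is within \<epsilon> of some \<open>x i\<close> as far as
      \<open>h\<close> is concerned, and the cycles link the \<open>x i\<close> within
      \<open>5 * \<epsilon>\<close>.\<close>
    have hQ: "\<bar>h p - h q\<bar> \<le> 7 * \<epsilon>" if pq: "p \<in> Q" "q \<in> Q" for p q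
    proof -
      have x_near: "\<exists>i\<in>I. \<bar>h r - h (x i)\<bar> \<le> \<epsilon>" if r: "r \<in> Q" for r
      proof -
        obtain i where "i \<in> I" "r = x i \<or> r = y i" using r unfolding Q_def by blast
        with hxy[of i] \<epsilon> show ?thesis by (intro bexI[of _ i]) (auto simp: abs_minus_commute)
      qed
      obtain i where i: "i \<in> I" "\<bar>h p - h (x i)\<bar> \<le> \<epsilon>" using x_near[OF pq(1)] by blast
      obtain j where j: "j \<in> I" "\<bar>h q - h (x j)\<bar> \<le> \<epsilon>" using x_near[OF pq(2)] by blast
      show ?thesis using hx[OF i(1) j(1)] i(2) j(2) by linarith
    qed
    \<comment> \<open>By (c), \<open>z\<close> lies almost on a segment from \<open>s\<close> to
      \<open>t\<close> along which both functions grow almost at full speed. Each growth from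
      \<open>s\<close> to \<open>z\<close> is thus within \<open>2 * \<epsilon>\<close> of
      \<open>dist z s\<close>.\<close>
    have hz: "\<exists>s\<in>Q. \<bar>h z - h s\<bar> \<le> 2 * \<epsilon>" for z
    proof -
      obtain s t where st: "s \<in> Q" "dist z s + dist z t < dist s t + \<epsilon>"
        and det: "\<forall>f. 1-lipschitz_on UNIV f \<and> (\<forall>i\<in>I. f (x i) - f (y i) > dist (x i) (y i) * (1 - \<alpha>)) \<longrightarrow>
            f t - f s > dist s t - \<epsilon>"
        using determined by blast
      have "lip0_apply f t - lip0_apply f s > dist s t - \<epsilon>" "lip0_apply g t - lip0_apply g s > dist s t - \<epsilon>"
        by (rule det[rule_format], use lip near[OF f] near[OF g] in blast)+
      then have "\<bar>h z - h s\<bar> \<le> 2 * \<epsilon>"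
        using st(2) up[OF f(1), of t z] up[OF g(1), of t z] up[OF f(1), of z s] up[OF g(1), of z s]
        unfolding h_def dist_commute[of t z] by linarith
      with st(1) show ?thesis by blast
    qed
    have osc: "\<bar>h z - h w\<bar> \<le> 11 * \<epsilon>" for z w
    proof -
      obtain s where s: "s \<in> Q" "\<bar>h z - h s\<bar> \<le> 2 * \<epsilon>" using hz[of z] by blast
      obtain t where t: "t \<in> Q" "\<bar>h w - h t\<bar> \<le> 2 * \<epsilon>" using hz[of w] by blast
      show ?thesis using hQ[OF s(1) t(1)] s(2) t(2) by linarith
    qed
    show ?thesis
    proof (rule norm_lip0_le)
      show "0 \<le> 11 * \<epsilon> / \<theta>" using \<epsilon> \<theta> by simp
      fix z w
      show "\<bar>lip0_apply (f - g) z - lip0_apply (f - g) w\<bar> \<le> 11 * \<epsilon> / \<theta> * dist z w"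
      proof (cases "z = w")
        case False
        \<comment> \<open>Distinct points are at least \<theta> apart, so a bound on the oscillation
          is a bound on the Lipschitz norm.\<close>
        have "\<bar>h z - h w\<bar> \<le> 11 * \<epsilon> / \<theta> * \<theta>" using osc[of z w] \<theta> by simp
        also have "\<dots> \<le> 11 * \<epsilon> / \<theta> * dist z w" using False \<theta> \<epsilon> by (intro mult_left_mono) auto
        finally show ?thesis by (simp add: h_def minus_lip0.rep_eq)
      qed simp
    qed
  qed
  then have "diameter (wstar_slice \<mu> (\<beta> / card I)) \<le> 11 * \<epsilon> / \<theta>"
    using \<epsilon> \<theta> by (intro diameter_le) (auto simp: wstar_slice_lipfree dist_lip0_pairing simp flip: dist_norm)
  also have "\<dots> < \<epsilon>0" using \<epsilon>0 \<theta> by (simp add: \<epsilon>_def)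
  finally show "\<exists>(\<mu> :: 'a lipfree) \<alpha>. norm \<mu> = 1 \<and> \<alpha> > 0 \<and> diameter (wstar_slice \<mu> \<alpha>) < \<epsilon>0"
    using \<mu>(1) \<beta> I n by (intro exI[of _ \<mu>] exI[of _ "\<beta> / card I"]) auto
qed

section \<open>From small slices to tight pairs\<close>

text \<open>Compactness is in the topology of pointwise convergence: the set is closed in a product
  of the intervals of radius \<open>dist x b\<close>, which is compact by Tychonoff's
  theorem.\<close>

lemma compact_lipschitz_vanishing:
  "compact {f :: 'a::metric_space \<Rightarrow> real. 1-lipschitz_on UNIV f \<and> f b = 0}" (is "compact ?K")
proof -
  let ?B = "Pi\<^sub>E UNIV (\<lambda>x. cball 0 (dist x b)) :: ('a \<Rightarrow> real) set"
  have "compactin (product_topology (\<lambda>_. euclidean) UNIV) ?B"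
    unfolding compactin_PiE by (simp add: compactin_euclidean_iff)
  then have "compact ?B" by (simp add: euclidean_product_topology compactin_euclidean_iff)
  moreover have "closed ?K"
    unfolding lipschitz_on_1_real_iff
    by (intro closed_Collect_conj closed_Collect_all closed_Collect_le closed_Collect_eq
        continuous_on_diff continuous_on_const continuous_on_product_coordinates)
  moreover have "?K \<subseteq> ?B"
  proof
    fix f assume f: "f \<in> ?K"
    have "\<bar>f x\<bar> \<le> dist x b" for x
      using f lipschitz_onD[of 1 UNIV f x b] by (simp add: dist_real_def)
    then show "f \<in> ?B" by (simp add: PiE_iff dist_real_def)
  qed
  ultimately show ?thesis using compact_Int_closed[of ?B ?K] by (simp only: inf.absorb2)
qed

lemma finite_positive_lower_bound:
  fixes \<gamma> :: "'i \<Rightarrow> real"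
  assumes "finite B" "\<And>b. b \<in> B \<Longrightarrow> 0 < \<gamma> b"
  shows "\<exists>t>0. \<forall>b\<in>B. t \<le> \<gamma> b"
proof (intro exI conjI ballI)
  \<comment> \<open>Inserting \<open>1\<close> covers an empty \<open>B\<close>.\<close>
  let ?t = "Min (insert 1 (\<gamma> ` B))"
  have "?t \<in> insert 1 (\<gamma> ` B)" using assms(1) by (intro Min_in) auto
  with assms(2) show "?t > 0" by fastforce
  show "?t \<le> \<gamma> b" if "b \<in> B" for b using assms(1) that by (intro Min_le) auto
qed

text \<open>Moving \<open>f0\<close> slightly away from \<open>f\<close> along the line through both keeps it \<open>1\<close>-Lipschitz on
  \<open>P\<close>: the tight pairs stay tight and the others have a gap.\<close>

lemma tight_imp_maximizer:
  fixes f f0 :: "'a::metric_space \<Rightarrow> real" and P b and c :: "'a \<Rightarrow> real"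
  defines "L g \<equiv> \<Sum>p\<in>P. c p * (g p - g b)"
  assumes P: "finite P" "b \<in> P"
    and f0: "1-lipschitz_on UNIV f0" "\<And>g. 1-lipschitz_on UNIV g \<Longrightarrow> L g \<le> L f0"
    and f: "1-lipschitz_on UNIV f"
    and tight: "\<And>p q. p \<in> P \<Longrightarrow> q \<in> P \<Longrightarrow> f0 p - f0 q = dist p q \<Longrightarrow> f p - f q = dist p q"
  shows "L f0 \<le> L f"
proof -
  note lip = f0(1)[unfolded lipschitz_on_1_real_iff, rule_format] f[unfolded lipschitz_on_1_real_iff, rule_format]
  define B where "B = {(p, q). p \<in> P \<and> q \<in> P \<and> f0 p - f0 q < dist p q}"
  have "finite B" by (rule finite_subset[of _ "P \<times> P"]) (auto simp: B_def P)
  moreover have pos: "dist p q > 0" if "f0 p - f0 q < dist p q" for p q using that by force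
  \<comment> \<open>Moving by \<open>t\<close> changes the difference over a pair by at most
    \<open>t * (2 * dist p q)\<close>, which this choice keeps within the gap of every pair that is
    not tight.\<close>
  ultimately obtain t where t: "t > 0" "\<And>p q. (p, q) \<in> B \<Longrightarrow> t \<le> (dist p q - (f0 p - f0 q)) / (2 * dist p q)"
    using finite_positive_lower_bound[of B "\<lambda>(p, q). (dist p q - (f0 p - f0 q)) / (2 * dist p q)"]
    by (fastforce simp: B_def)
  define h where "h p = f0 p + t * (f0 p - f p)" for p
  have "h p - h q \<le> dist p q" if pq: "p \<in> P" "q \<in> P" for p q
  proof (cases "f0 p - f0 q = dist p q")
    case True
    have "h p - h q = (f0 p - f0 q) + t * ((f0 p - f0 q) - (f p - f q))"
      by (simp add: h_def algebra_simps)
    with True tight[OF pq True] show ?thesis by simp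
  next
    case False
    then have less: "f0 p - f0 q < dist p q" using lip(1)[of p q] by simp
    then have "t \<le> (dist p q - (f0 p - f0 q)) / (2 * dist p q)" using t(2) pq by (simp add: B_def)
    then have "t * (2 * dist p q) \<le> dist p q - (f0 p - f0 q)"
      using pos[OF less] by (simp add: pos_le_divide_eq)
    moreover have "t * ((f0 p - f0 q) + (f q - f p)) \<le> t * (2 * dist p q)"
      using t(1) lip(1)[of p q] lip(2)[of q p] by (intro mult_left_mono) (auto simp: dist_commute)
    ultimately show ?thesis by (simp add: h_def algebra_simps)
  qed
  note h = this
  have "P \<noteq> {}" using P by blast
  then obtain g where g: "1-lipschitz_on UNIV g" "\<And>p. p \<in> P \<Longrightarrow> g p = h p"
  proof (rule lipschitz_extension_largest[OF P(1) _ h])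
    fix g assume "1-lipschitz_on UNIV g" "\<And>p. p \<in> P \<Longrightarrow> g p = h p"
    then show thesis by (rule that)
  qed
  \<comment> \<open>\<open>L\<close> is affine along the line through \<open>f\<close> and
    \<open>f0\<close>; were \<open>L f\<close> smaller than \<open>L f0\<close>, moving away from
    \<open>f\<close> would exceed the maximum.\<close>
  have "L g = (\<Sum>p\<in>P. c p * (f0 p - f0 b) + t * (c p * (f0 p - f0 b) - c p * (f p - f b)))"
    unfolding L_def using P by (intro sum.cong) (auto simp: g h_def algebra_simps)
  also have "\<dots> = L f0 + t * (L f0 - L f)"
    by (simp add: L_def sum.distrib sum_subtractf sum_distrib_left[symmetric])
  finally have "t * (L f0 - L f) \<le> 0" using f0(2)[OF g(1)] by simp
  with t(1) show ?thesis by (simp add: mult_le_0_iff)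
qed

text \<open>The normalised functions with \<open>L f \<le> L f0 - \<beta>\<close> form a compact
  set, on which the total slack over the tight pairs attains its minimum. Zero slack would make the
  function a maximiser, so the minimum is positive, and an almost tight function with smaller slack
  must lie outside.\<close>

lemma near_tight_imp_near_maximizer:
  fixes P :: "'a::metric_space set" and b and c :: "'a \<Rightarrow> real"
  defines "L \<equiv> \<lambda>f. \<Sum>p\<in>P. c p * (f p - f b)"
  assumes P: "finite P" "b \<in> P"
  obtains f0 :: "'a \<Rightarrow> real" where "1-lipschitz_on UNIV f0"
    "\<And>f. 1-lipschitz_on UNIV f \<Longrightarrow> L f \<le> L f0"
    "\<And>\<beta>. \<beta> > 0 \<Longrightarrow> \<exists>\<alpha>>0. \<forall>f. 1-lipschitz_on UNIV f \<and>
      (\<forall>p\<in>P. \<forall>q\<in>P. p \<noteq> q \<and> f0 p - f0 q = dist p q \<longrightarrow> dist p q * (1 - \<alpha>) < f p - f q) \<longrightarrow>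
      L f0 - \<beta> < L f"
proof -
  define K where "K = {f :: 'a \<Rightarrow> real. 1-lipschitz_on UNIV f \<and> f b = 0}"
  have K: "compact K" unfolding K_def by (rule compact_lipschitz_vanishing)
  have cont: "continuous_on S (\<lambda>f :: 'a \<Rightarrow> real. f p)" for S p
    by (rule continuous_on_subset[OF continuous_on_product_coordinates]) simp
  have contL: "continuous_on S L" for S
    unfolding L_def by (intro continuous_intros cont)
  have "(\<lambda>_. 0) \<in> K" by (simp add: K_def lipschitz_on_1_real_iff)
  then obtain f0 where f0: "f0 \<in> K" "\<And>f. f \<in> K \<Longrightarrow> L f \<le> L f0"
    using continuous_attains_sup[OF K _ contL] by blast
  have shift: "(\<lambda>z. f z - f b) \<in> K" "L (\<lambda>z. f z - f b) = L f" if "1-lipschitz_on UNIV f" for f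
    using that by (auto simp: K_def L_def lipschitz_on_1_real_iff)
  have lip0: "1-lipschitz_on UNIV f0" using f0(1) by (simp add: K_def)
  have max: "L f \<le> L f0" if "1-lipschitz_on UNIV f" for f
    using f0(2)[OF shift(1)[OF that]] shift(2)[OF that] by simp
  define A where "A = {(p, q). p \<in> P \<and> q \<in> P \<and> p \<noteq> q \<and> f0 p - f0 q = dist p q}"
  have A: "finite A" by (rule finite_subset[of _ "P \<times> P"]) (auto simp: A_def P)
  define \<phi> where "\<phi> f = (\<Sum>(p, q)\<in>A. dist p q - (f p - f q))" for f :: "'a \<Rightarrow> real"
  have "\<exists>\<alpha>>0. \<forall>f. 1-lipschitz_on UNIV f \<and>
      (\<forall>p\<in>P. \<forall>q\<in>P. p \<noteq> q \<and> f0 p - f0 q = dist p q \<longrightarrow> dist p q * (1 - \<alpha>) < f p - f q) \<longrightarrow>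
      L f0 - \<beta> < L f" if \<beta>: "\<beta> > 0" for \<beta>
  proof -
    define K' where "K' = K \<inter> {f. L f \<le> L f0 - \<beta>}"
    have K': "compact K'" unfolding K'_def
      by (intro compact_Int_closed K closed_Collect_le contL continuous_on_const)
    have outside: "L f0 - \<beta> < L f" if "1-lipschitz_on UNIV f" "(\<lambda>z. f z - f b) \<notin> K'" for f
      using that shift[OF that(1)] by (auto simp: K'_def)
    show ?thesis
    proof (cases "K' = {}")
      case True
      with outside show ?thesis by (intro exI[of _ 1]) auto
    next
      case False
      have "continuous_on K' \<phi>"
        unfolding \<phi>_def case_prod_beta by (intro continuous_intros cont)
      then obtain f1 where f1: "f1 \<in> K'" "\<And>f. f \<in> K' \<Longrightarrow> \<phi> f1 \<le> \<phi> f"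
        using continuous_attains_inf[OF K' False] by blast
      then have lip1: "1-lipschitz_on UNIV f1" and L1: "L f1 \<le> L f0 - \<beta>" by (auto simp: K'_def K_def)
      have nonneg: "0 \<le> dist p q - (f1 p - f1 q)" for p q
        using lip1 by (simp add: lipschitz_on_1_real_iff)
      have "\<phi> f1 \<noteq> 0"
      proof
        assume "\<phi> f1 = 0"
        then have "\<forall>pq\<in>A. (case pq of (p, q) \<Rightarrow> dist p q - (f1 p - f1 q)) = 0"
          unfolding \<phi>_def using A nonneg by (subst (asm) sum_nonneg_eq_0_iff) auto
        then have tight: "f1 p - f1 q = dist p q" if "p \<in> P" "q \<in> P" "f0 p - f0 q = dist p q" for p q
          using that by (cases "p = q") (auto simp: A_def)
        have "L f0 \<le> L f1"
          unfolding L_def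
          by (rule tight_imp_maximizer[OF P lip0 max[unfolded L_def] lip1 tight])
        with L1 \<beta> show False by simp
      qed
      moreover have "0 \<le> \<phi> f1" unfolding \<phi>_def using nonneg by (intro sum_nonneg) auto
      ultimately have \<phi>1: "0 < \<phi> f1" by simp
      define S where "S = (\<Sum>(p, q)\<in>A. dist p q)"
      have S: "0 \<le> S" unfolding S_def by (intro sum_nonneg) auto
      \<comment> \<open>Dividing by \<open>1 + S\<close> makes \<open>\<alpha> * S\<close> strictly
        smaller than the minimal slack, even if there are no tight pairs and
        \<open>S = 0\<close>.\<close>
      define \<alpha> where "\<alpha> = \<phi> f1 / (1 + S)"
      have \<alpha>: "\<alpha> > 0" "\<alpha> * S < \<phi> f1" using \<phi>1 S by (auto simp: \<alpha>_def field_simps)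
      have "L f0 - \<beta> < L f"
        if f: "1-lipschitz_on UNIV f"
          "\<forall>p\<in>P. \<forall>q\<in>P. p \<noteq> q \<and> f0 p - f0 q = dist p q \<longrightarrow> dist p q * (1 - \<alpha>) < f p - f q" for f
      proof (rule outside[OF f(1)])
        have "\<phi> (\<lambda>z. f z - f b) \<le> (\<Sum>(p, q)\<in>A. \<alpha> * dist p q)"
          unfolding \<phi>_def
        proof (rule sum_mono)
          fix pq assume "pq \<in> A"
          with f(2) show "(case pq of (p, q) \<Rightarrow> dist p q - (f p - f b - (f q - f b)))
              \<le> (case pq of (p, q) \<Rightarrow> \<alpha> * dist p q)"
            by (force simp: A_def algebra_simps)
        qed
        also have "\<dots> = \<alpha> * S" by (simp add: S_def sum_distrib_left case_prod_beta)
        also have "\<dots> < \<phi> f1" by (rule \<alpha>)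
        finally show "(\<lambda>z. f z - f b) \<notin> K'" using f1(2) by force
      qed
      with \<alpha>(1) show ?thesis by blast
    qed
  qed
  with that lip0 max show ?thesis by blast
qed

section \<open>Finitely supported slicing elements and their tight pairs\<close>

lemma span_range_explicit:
  fixes h :: "'i \<Rightarrow> 'b::real_vector"
  assumes "v \<in> span (range h)"
  obtains P c where "finite P" "v = (\<Sum>p\<in>P. c p *\<^sub>R h p)"
proof -
  obtain T r where T: "finite T" "T \<subseteq> range h" "v = (\<Sum>a\<in>T. r a *\<^sub>R a)"
    using assms unfolding span_explicit by auto
  obtain P where "inj_on h P" "T = h ` P"
    using T(2) by (auto simp: subset_image_inj)
  then have "finite P" using T(1) finite_imageD by blast
  with \<open>inj_on h P\<close> \<open>T = h ` P\<close> show ?thesis using that[of P "\<lambda>p. r (h p)"] by (simp add: T(3) sum.reindex)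
qed

text \<open>Replacing the slicing element by a nearby finite combination of evaluations costs little
  on the unit ball. Functions almost tight where its maximiser is tight therefore lie in the
  original slice, whose diameter bounds their differences.\<close>

lemma tight_pairs_if_dual_wstar_BDP:
  assumes "dual_wstar_BDP TYPE('a::{metric_space,zero} lipfree)" and \<eta>: "\<eta> > 0"
  shows "\<exists>A (f0 :: 'a \<Rightarrow> real) \<alpha>. finite A \<and> A \<noteq> {} \<and> 1-lipschitz_on UNIV f0 \<and>
    (\<forall>(p, q)\<in>A. p \<noteq> q \<and> f0 p - f0 q = dist p q) \<and> \<alpha> > 0 \<and>
    (\<forall>f g z w. 1-lipschitz_on UNIV f \<and> 1-lipschitz_on UNIV g \<and>
      (\<forall>(p, q)\<in>A. dist p q * (1 - \<alpha>) < f p - f q) \<and>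
      (\<forall>(p, q)\<in>A. dist p q * (1 - \<alpha>) < g p - g q) \<longrightarrow>
      \<bar>(f z - g z) - (f w - g w)\<bar> \<le> \<eta> * dist z w)"
proof -
  obtain \<mu> :: "'a lipfree" and \<alpha>0 where \<mu>: "norm \<mu> = 1" "\<alpha>0 > 0" "diameter (wstar_slice \<mu> \<alpha>0) < \<eta>"
    using assms unfolding dual_wstar_BDP_def by blast
  \<comment> \<open>Four losses of \<delta> have to fit into \<open>\<alpha>0\<close>: almost
    norming \<mu>, passing to \<nu>, almost maximising, and passing back to \<mu>. The cap at
    \<open>1\<close> is used to exclude an empty set of tight pairs.\<close>
  define \<delta> where "\<delta> = min \<alpha>0 1 / 4"
  have \<delta>: "\<delta> > 0" "4 * \<delta> \<le> \<alpha>0" "4 * \<delta> \<le> 1" using \<mu> by (auto simp: \<delta>_def)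
  have "\<mu> \<in> closure (span (range lipfree_delta))" by (simp add: closure_span_lipfree_delta)
  then obtain \<nu> where \<nu>: "\<nu> \<in> span (range lipfree_delta)" "norm (\<nu> - \<mu>) < \<delta>"
    using \<delta> unfolding closure_approachable dist_norm by blast
  obtain P0 c0 where P0: "finite P0" "\<nu> = (\<Sum>p\<in>P0. c0 p *\<^sub>R lipfree_delta p)"
    using span_range_explicit[OF \<nu>(1)] .
  define P where "P = insert 0 P0"
  define c where "c p = (if p \<in> P0 then c0 p else 0)" for p
  have P: "finite P" "0 \<in> P" by (auto simp: P_def P0)
  define L where "L f = (\<Sum>p\<in>P. c p * (f p - f 0))" for f :: "'a \<Rightarrow> real"
  have pair: "blinfun_apply (lip0_pairing f) \<nu> = L (lip0_apply f)" for f
  proof -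
    have "blinfun_apply (lip0_pairing f) \<nu> = (\<Sum>p\<in>P0. c p * lip0_apply f p)"
      by (simp add: P0 c_def blinfun.sum_right blinfun.scaleR_right)
    also have "\<dots> = L (lip0_apply f)"
      unfolding L_def using P0(1) by (intro sum.mono_neutral_cong_left) (auto simp: P_def c_def)
    finally show ?thesis .
  qed
  have near: "\<bar>blinfun_apply (lip0_pairing f) \<nu> - blinfun_apply (lip0_pairing f) \<mu>\<bar> < \<delta>"
    if "norm f \<le> 1" for f
  proof -
    have "\<bar>blinfun_apply (lip0_pairing f) (\<nu> - \<mu>)\<bar> \<le> norm f * norm (\<nu> - \<mu>)"
      by (rule abs_lip0_pairing_le)
    also have "\<dots> \<le> 1 * norm (\<nu> - \<mu>)" using that by (intro mult_right_mono) auto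
    finally show ?thesis using \<nu>(2) by (simp add: blinfun.diff_right)
  qed
  obtain f0 :: "'a \<Rightarrow> real" where f0: "1-lipschitz_on UNIV f0"
    "\<And>f. 1-lipschitz_on UNIV f \<Longrightarrow> L f \<le> L f0"
    "\<And>\<beta>. \<beta> > 0 \<Longrightarrow> \<exists>\<alpha>>0. \<forall>f. 1-lipschitz_on UNIV f \<and>
      (\<forall>p\<in>P. \<forall>q\<in>P. p \<noteq> q \<and> f0 p - f0 q = dist p q \<longrightarrow> dist p q * (1 - \<alpha>) < f p - f q) \<longrightarrow>
      L f0 - \<beta> < L f"
  proof (rule near_tight_imp_near_maximizer[OF P, of c, folded L_def])
    fix f0 :: "'a \<Rightarrow> real"
    assume "1-lipschitz_on UNIV f0" "\<And>f. 1-lipschitz_on UNIV f \<Longrightarrow> L f \<le> L f0"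
      "\<And>\<beta>. \<beta> > 0 \<Longrightarrow> \<exists>\<alpha>>0. \<forall>f. 1-lipschitz_on UNIV f \<and>
        (\<forall>p\<in>P. \<forall>q\<in>P. p \<noteq> q \<and> f0 p - f0 q = dist p q \<longrightarrow> dist p q * (1 - \<alpha>) < f p - f q) \<longrightarrow>
        L f0 - \<beta> < L f"
    then show thesis by (rule that)
  qed
  obtain k :: "'a lip0" where k: "norm k \<le> 1" "1 - \<delta> < blinfun_apply (lip0_pairing k) \<mu>"
    using lipfree_norming[of "1 - \<delta>" \<mu>] \<mu> \<delta> by auto
  have Lf0: "1 - 2 * \<delta> < L f0"
    using near[OF k(1)] k(2) f0(2)[of "lip0_apply k"] k(1)
    by (simp add: pair lip0_norm_le_1_iff)
  from f0(3)[OF \<delta>(1)] obtain \<alpha> where \<alpha>: "\<alpha> > 0 \<and> (\<forall>f. 1-lipschitz_on UNIV f \<and>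
      (\<forall>p\<in>P. \<forall>q\<in>P. p \<noteq> q \<and> f0 p - f0 q = dist p q \<longrightarrow> dist p q * (1 - \<alpha>) < f p - f q) \<longrightarrow>
      L f0 - \<delta> < L f)" ..
  define A where "A = {(p, q). p \<in> P \<and> q \<in> P \<and> p \<noteq> q \<and> f0 p - f0 q = dist p q}"
  have in_slice: "L f0 - \<delta> < L f"
    if "1-lipschitz_on UNIV f" "\<forall>(p, q)\<in>A. dist p q * (1 - \<alpha>) < f p - f q" for f
    by (rule \<alpha>[THEN conjunct2, rule_format]) (use that in \<open>auto simp: A_def\<close>)
  have finA: "finite A" by (rule finite_subset[of _ "P \<times> P"]) (auto simp: A_def P)
  have neA: "A \<noteq> {}"
  proof
    assume "A = {}"
    \<comment> \<open>Without tight pairs even the zero function would almost maximise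
      \<open>L\<close>, whose maximum is close to one.\<close>
    then have "L f0 - \<delta> < L (\<lambda>_. 0)" by (intro in_slice) (auto simp: lipschitz_on_1_real_iff)
    then show False using Lf0 \<delta> by (simp add: L_def)
  qed
  have lift: "\<exists>F. lip0_pairing F \<in> wstar_slice \<mu> \<alpha>0 \<and> (\<forall>x. lip0_apply F x = h x - h 0)"
    if h: "1-lipschitz_on UNIV h" "L f0 - \<delta> < L h" for h
  proof -
    obtain F where F: "norm F \<le> 1" "\<And>x. lip0_apply F x = h x - h 0"
      using lip0_of_lipschitz[OF h(1)] by blast
    have "L (lip0_apply F) = L h" by (simp add: L_def F)
    then have "1 - \<alpha>0 < blinfun_apply (lip0_pairing F) \<mu>"
      using near[OF F(1)] h(2) Lf0 \<delta> by (simp add: pair)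
    with F show ?thesis by (auto simp: wstar_slice_def norm_lip0_pairing)
  qed
  have osc: "\<bar>(f z - g z) - (f w - g w)\<bar> \<le> \<eta> * dist z w"
    if f: "1-lipschitz_on UNIV f" "\<forall>(p, q)\<in>A. dist p q * (1 - \<alpha>) < f p - f q"
      and g: "1-lipschitz_on UNIV g" "\<forall>(p, q)\<in>A. dist p q * (1 - \<alpha>) < g p - g q" for f g z w
  proof -
    obtain F where F: "lip0_pairing F \<in> wstar_slice \<mu> \<alpha>0" "\<And>x. lip0_apply F x = f x - f 0"
      using lift[OF f(1) in_slice[OF f]] by blast
    obtain G where G: "lip0_pairing G \<in> wstar_slice \<mu> \<alpha>0" "\<And>x. lip0_apply G x = g x - g 0"
      using lift[OF g(1) in_slice[OF g]] by blast
    have "norm (F - G) \<le> \<eta>"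
      using diameter_bounded_bound[OF bounded_wstar_slice F(1) G(1)] \<mu>(3) by (simp add: dist_lip0_pairing)
    then have "norm (F - G) * dist z w \<le> \<eta> * dist z w" by (intro mult_right_mono) auto
    then show ?thesis
      using lip0_diff_le[of "F - G" z w] by (simp add: minus_lip0.rep_eq F(2) G(2) algebra_simps)
  qed
  have "\<forall>(p, q)\<in>A. p \<noteq> q \<and> f0 p - f0 q = dist p q" by (auto simp: A_def)
  with finA neA f0(1) \<alpha>[THEN conjunct1] osc show ?thesis
    by (intro exI[of _ A] exI[of _ f0] exI[of _ \<alpha>] conjI allI impI; (elim conjE)?) blast+
qed

section \<open>From tight pairs to the metric condition\<close>

text \<open>If all paths from \<open>J\<close> to \<open>K\<close> had slack at least \<epsilon>,
  the potential over chains ending in \<open>K\<close> would be tight on \<open>A\<close>, yet its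
  difference from \<open>f0\<close> would vary by at least \<epsilon> between the first points of
  \<open>J\<close> and \<open>K\<close>.\<close>

lemma short_path_between_tight_pairs:
  fixes A :: "('a::metric_space \<times> 'a) set"
  assumes A: "finite A" and f0: "1-lipschitz_on UNIV f0" "\<And>p q. (p, q) \<in> A \<Longrightarrow> f0 p - f0 q = dist p q"
    and osc: "\<And>f z w. 1-lipschitz_on UNIV f \<Longrightarrow> (\<And>p q. (p, q) \<in> A \<Longrightarrow> f p - f q = dist p q) \<Longrightarrow>
      \<bar>(f z - f0 z) - (f w - f0 w)\<bar> < \<epsilon>"
    and JK: "J \<in> A" "K \<in> A"
  defines "a \<equiv> \<lambda>i j. dist (fst i) (snd j) - (f0 (fst i) - f0 (snd j))"
  shows "\<exists>l. l \<noteq> [] \<and> set l \<subseteq> A \<and> hd l = J \<and> last l = K \<and> path_sum a l < \<epsilon>"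
proof (rule ccontr)
  assume "\<not> ?thesis"
  then have long: "\<epsilon> \<le> path_sum a l" if "l \<noteq> []" "set l \<subseteq> A" "hd l = J" "last l = K" for l
    using that by force
  have nonneg: "0 \<le> a i j" for i j using f0(1) by (simp add: a_def lipschitz_on_1_real_iff)
  have sum_tight: "(\<Sum>i\<leftarrow>l. f0 (fst i) - f0 (snd i)) = (\<Sum>i\<leftarrow>l. dist (fst i) (snd i))" if "set l \<subseteq> A" for l
    using that f0(2) by (intro arg_cong[of _ _ sum_list] map_cong) auto
  have mono: "(\<Sum>i\<leftarrow>l. dist (fst i) (snd i)) \<le> cyclic_sum (\<lambda>i j. dist (fst i) (snd j)) l"
    if "l \<noteq> []" "set l \<subseteq> A" for l
    using cyclic_sum_nonneg[of l a] nonneg sum_tight[OF that(2)] by (simp add: a_def cyclic_sum_slack)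
  define C where "C = {l. l \<noteq> [] \<and> set l \<subseteq> A \<and> last l = K}"
  have KC: "[K] \<in> C" using JK by (simp add: C_def)
  then have "C \<noteq> {}" by blast
  then have C: "C \<noteq> {}" "\<And>l. l \<in> C \<Longrightarrow> l \<noteq> [] \<and> set l \<subseteq> A"
    "\<And>i l. i \<in> A \<Longrightarrow> l \<in> C \<Longrightarrow> i # l \<in> C"
    by (auto simp: C_def)
  define \<phi> where "\<phi> l = path_sum (\<lambda>i j. dist (fst i) (snd j)) l - (\<Sum>i\<leftarrow>l. dist (fst i) (snd i))"
    for l :: "('a \<times> 'a) list"
  obtain f :: "'a \<Rightarrow> real" where f: "1-lipschitz_on UNIV f"
    "\<And>i. i \<in> A \<Longrightarrow> f (fst i) - f (snd i) = dist (fst i) (snd i)"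
    "\<And>l z. l \<in> C \<Longrightarrow> f z \<le> \<phi> l + dist z (snd (hd l))"
    "\<And>c z. (\<And>l. l \<in> C \<Longrightarrow> c \<le> \<phi> l + dist z (snd (hd l))) \<Longrightarrow> c \<le> f z"
  proof (rule cyclically_monotone_potential[OF A mono C, folded \<phi>_def])
    fix f :: "'a \<Rightarrow> real"
    assume "1-lipschitz_on UNIV f" "\<And>i. i \<in> A \<Longrightarrow> f (fst i) - f (snd i) = dist (fst i) (snd i)"
      "\<And>l z. l \<in> C \<Longrightarrow> f z \<le> \<phi> l + dist z (snd (hd l))"
      "\<And>c z. (\<And>l. l \<in> C \<Longrightarrow> c \<le> \<phi> l + dist z (snd (hd l))) \<Longrightarrow> c \<le> f z"
    then show thesis by (rule that)
  qed
  have "f (snd K) \<le> - dist (fst K) (snd K)" using f(3)[OF KC, of "snd K"] by (simp add: \<phi>_def)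
  then have fK: "f (fst K) \<le> 0" using f(2)[OF JK(2)] by simp
  have fJ: "\<epsilon> + f0 (fst J) - f0 (fst K) \<le> f (fst J)"
  proof (rule f(4))
    fix l assume l: "l \<in> C"
    then have l': "l \<noteq> []" "set l \<subseteq> A" "last l = K" by (auto simp: C_def)
    \<comment> \<open>Prepending \<open>J\<close> turns the chain into a path from \<open>J\<close>
      to \<open>K\<close>, to which the assumed lower bound applies.\<close>
    have "\<epsilon> \<le> path_sum a (J # l)" using l' JK by (intro long) auto
    also have "path_sum a (J # l) = a J (hd l) + path_sum a l"
      using l'(1) by (cases l) auto
    also have "path_sum a l = \<phi> l + f0 (fst K) - f0 (snd (hd l))"
      using path_sum_slack[OF l'(1), of "\<lambda>i j. dist (fst i) (snd j)" "\<lambda>i. f0 (fst i)" "\<lambda>i. f0 (snd i)"]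
        sum_tight[OF l'(2)] l'(3) by (simp add: a_def \<phi>_def)
    finally show "\<epsilon> + f0 (fst J) - f0 (fst K) \<le> \<phi> l + dist (fst J) (snd (hd l))"
      by (simp add: a_def)
  qed
  have "\<bar>(f (fst J) - f0 (fst J)) - (f (fst K) - f0 (fst K))\<bar> < \<epsilon>"
    using f(2) by (intro osc f(1)) force
  with fK fJ show False by linarith
qed

text \<open>Every tight pair is used twice, so that a path from \<open>j\<close> to \<open>k\<close> through first copies and
  one from \<open>k\<close> to \<open>j\<close> through second copies close up to a cycle without repetition.\<close>

lemma small_slice_family_if_tight_pairs:
  fixes A :: "('a::metric_space \<times> 'a) set"
  assumes A: "finite A" "A \<noteq> {}" and f0: "1-lipschitz_on UNIV f0"
    and tight: "\<And>p q. (p, q) \<in> A \<Longrightarrow> p \<noteq> q \<and> f0 p - f0 q = dist p q"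
    and \<alpha>: "\<alpha> > 0"
    and osc: "\<And>f z w. 1-lipschitz_on UNIV f \<Longrightarrow>
      (\<And>p q. (p, q) \<in> A \<Longrightarrow> dist p q * (1 - \<alpha>) < f p - f q) \<Longrightarrow>
      \<bar>(f z - f0 z) - (f w - f0 w)\<bar> \<le> \<kappa>"
    and \<kappa>: "3 * \<kappa> < \<epsilon>" "\<kappa> < \<theta>" and \<theta>: "\<And>x y :: 'a. x \<noteq> y \<Longrightarrow> \<theta> \<le> dist x y"
  shows "\<exists>n\<ge>1. \<exists>x y :: nat \<Rightarrow> 'a. small_slice_family \<epsilon> \<alpha> n x y"
proof -
  have osc_tight: "\<bar>(f z - f0 z) - (f w - f0 w)\<bar> \<le> \<kappa>"
    if "1-lipschitz_on UNIV f" "\<And>p q. (p, q) \<in> A \<Longrightarrow> f p - f q = dist p q" for f z w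
  proof (rule osc[OF that(1)])
    fix p q assume pq: "(p, q) \<in> A"
    then have "dist p q * (1 - \<alpha>) < dist p q * 1"
      using tight[OF pq] \<alpha> by (intro mult_strict_left_mono) auto
    then show "dist p q * (1 - \<alpha>) < f p - f q" using that(2)[OF pq] by simp
  qed
  have "0 \<le> \<kappa>" using osc_tight[OF f0, of undefined undefined] tight by force
  then have \<epsilon>: "\<epsilon> > 0" using \<kappa> by simp
  define n where "n = card (A \<times> (UNIV :: bool set))"
  have "finite (A \<times> (UNIV :: bool set))" using A by simp
  then obtain e where e: "bij_betw e {1..n} (A \<times> (UNIV :: bool set))"
    unfolding n_def using ex_bij_betw_nat_finite_1 by blast
  have n: "n \<ge> 1" using A by (simp add: n_def Suc_le_eq card_gt_0_iff)
  define x where "x i = fst (fst (e i))" for i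
  define y where "y i = snd (fst (e i))" for i
  define e' where "e' = inv_into {1..n} e"
  have e'_in: "e' (p, c) \<in> {1..n}" and e_e': "e (e' (p, c)) = (p, c)" if "p \<in> A" for p c
    using that bij_betw_inv_into_right[OF e, of "(p, c)"] bij_betw_apply[OF bij_betw_inv_into[OF e], of "(p, c)"]
    by (auto simp: e'_def)
  have eA: "fst (e i) \<in> A" if "i \<in> {1..n}" for i
    using bij_betw_apply[OF e that] by auto
  have xyA: "(x i, y i) \<in> A" if "i \<in> {1..n}" for i
    using eA[OF that] by (simp add: x_def y_def)
  have xy_ex: "\<exists>i\<in>{1..n}. x i = p \<and> y i = q" if "(p, q) \<in> A" for p q
    using that e'_in[OF that] e_e'[OF that] by (intro bexI[of _ "e' ((p, q), True)"]) (auto simp: x_def y_def)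
  define a where "a = (\<lambda>(i :: 'a \<times> 'a) (j :: 'a \<times> 'a). dist (fst i) (snd j) - (f0 (fst i) - f0 (snd j)))"
  have a_nonneg: "0 \<le> a i j" for i j using f0 by (simp add: a_def lipschitz_on_1_real_iff)
  \<comment> \<open>Since \<open>f0\<close> is tight on every pair, the two sides of (a) and (b)
    differ exactly by the slack of \<open>f0\<close> around the cycle.\<close>
  have slack: "cyclic_sum (\<lambda>i j. a (fst (e i)) (fst (e j))) l
      = cyclic_dist_sum x y l - (\<Sum>i\<leftarrow>l. dist (x i) (y i))" if "set l \<subseteq> {1..n}" for l
  proof -
    have "(\<Sum>i\<leftarrow>l. f0 (x i) - f0 (y i)) = (\<Sum>i\<leftarrow>l. dist (x i) (y i))"
      using that tight[OF xyA] by (intro arg_cong[of _ _ sum_list] map_cong) auto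
    then show ?thesis
      by (simp add: a_def cyclic_dist_sum_eq cyclic_sum_slack flip: x_def y_def)
  qed
  have path: "\<exists>m. distinct m \<and> set m \<subseteq> A \<and> J \<notin> set m \<and> K \<notin> set m \<and> path_sum a (J # m @ [K]) < \<epsilon> / 2"
    if JK: "J \<in> A" "K \<in> A" "J \<noteq> K" for J K
  proof -
    have "\<exists>l. l \<noteq> [] \<and> set l \<subseteq> A \<and> hd l = J \<and> last l = K \<and> path_sum a l < \<epsilon> / 2"
      unfolding a_def
    proof (rule short_path_between_tight_pairs[OF A(1) f0 _ _ JK(1,2)])
      show "\<bar>(f z - f0 z) - (f w - f0 w)\<bar> < \<epsilon> / 2"
        if "1-lipschitz_on UNIV f" "\<And>p q. (p, q) \<in> A \<Longrightarrow> f p - f q = dist p q" for f z w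
        using osc_tight[OF that, of z w] \<kappa> \<open>0 \<le> \<kappa>\<close> by linarith
    qed (use tight in blast)
    then obtain l0 where "l0 \<noteq> []" "set l0 \<subseteq> A" "hd l0 = J" "last l0 = K" "path_sum a l0 < \<epsilon> / 2" by blast
    with loop_erasure[of l0 a] a_nonneg obtain l where l: "l \<noteq> []" "distinct l" "set l \<subseteq> A"
      "hd l = J" "last l = K" "path_sum a l < \<epsilon> / 2" by fastforce
    obtain m where m: "l = J # m @ [K]" "J \<notin> set m" "K \<notin> set m" "distinct m"
      using simple_path_form[of l] l JK(3) by metis
    with l show ?thesis by (intro exI[of _ m]) auto
  qed
  have cycles: "\<exists>is. distinct is \<and> set is \<subseteq> {1..n} \<and> j \<in> set is \<and> k \<in> set is \<and>
      cyclic_dist_sum x y is - \<epsilon> < (\<Sum>i\<leftarrow>is. dist (x i) (y i))"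
    if jk: "j \<in> {1..n}" "k \<in> {1..n}" "j \<noteq> k" for j k
  \<comment> \<open>If \<open>j\<close> and \<open>k\<close> are the two copies of one pair, the
    cycle through just these two has equal sums on both sides.\<close>
  proof (cases "fst (e j) = fst (e k)")
    case True
    then have "x j = x k" "y j = y k" by (auto simp: x_def y_def)
    then show ?thesis using jk \<epsilon>
      by (intro exI[of _ "[j, k]"]) (auto simp: cyclic_dist_sum_def numeral_2_eq_2)
  next
    case False
    define J K where "J = fst (e j)" and "K = fst (e k)"
    have JK: "J \<in> A" "K \<in> A" "J \<noteq> K" using eA jk False by (auto simp: J_def K_def)
    obtain m1 where m1: "distinct m1" "set m1 \<subseteq> A" "J \<notin> set m1" "K \<notin> set m1" "path_sum a (J # m1 @ [K]) < \<epsilon> / 2"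
      using path[OF JK] by blast
    obtain m2 where m2: "distinct m2" "set m2 \<subseteq> A" "J \<notin> set m2" "K \<notin> set m2" "path_sum a (K # m2 @ [J]) < \<epsilon> / 2"
      using path[OF JK(2,1)] JK(3) by blast
    define s1 s2 where "s1 = map (\<lambda>p. e' (p, True)) m1" and "s2 = map (\<lambda>p. e' (p, False)) m2"
    define l where "l = j # s1 @ k # s2"
    have e_s1: "map e s1 = map (\<lambda>p. (p, True)) m1" and e_s2: "map e s2 = map (\<lambda>p. (p, False)) m2"
      using m1(2) m2(2) e_e' by (auto simp: s1_def s2_def)
    have fst_s: "map (\<lambda>i. fst (e i)) s1 = m1" "map (\<lambda>i. fst (e i)) s2 = m2"
      using arg_cong[OF e_s1, of "map fst"] arg_cong[OF e_s2, of "map fst"] by (simp_all add: comp_def)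
    have set_l: "set l \<subseteq> {1..n}"
      using jk m1(2) m2(2) e'_in by (auto simp: l_def s1_def s2_def simp del: atLeastAtMost_iff)
    have "map e l = e j # map (\<lambda>p. (p, True)) m1 @ e k # map (\<lambda>p. (p, False)) m2"
      by (simp add: l_def e_s1 e_s2)
    \<comment> \<open>The Boolean tags separate the two paths, and the inner pairs avoid
      \<open>J\<close> and \<open>K\<close>, so no copy is used twice whichever copies
      \<open>j\<close> and \<open>k\<close> are.\<close>
    moreover have "distinct \<dots>"
      using m1(1,3,4) m2(1,3,4) False
      by (auto simp: distinct_map inj_on_def J_def K_def image_iff)
    ultimately have "distinct (map e l)" by simp
    then have dist_l: "distinct l" by (simp add: distinct_map)
    let ?w = "\<lambda>i j. a (fst (e i)) (fst (e j))"
    have "cyclic_sum ?w l = path_sum ?w (j # s1 @ [k]) + path_sum ?w (k # s2 @ [j])"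
      using path_sum_append[of ?w "j # s1" k "s2 @ [j]"] by (simp add: l_def cyclic_sum_Cons)
    also have "path_sum ?w (j # s1 @ [k]) = path_sum a (J # m1 @ [K])"
      using path_sum_map[of a "\<lambda>i. fst (e i)" "j # s1 @ [k]"] by (simp add: fst_s J_def K_def)
    also have "path_sum ?w (k # s2 @ [j]) = path_sum a (K # m2 @ [J])"
      using path_sum_map[of a "\<lambda>i. fst (e i)" "k # s2 @ [j]"] by (simp add: fst_s J_def K_def)
    finally have "cyclic_sum ?w l < \<epsilon>" using m1(5) m2(5) by simp
    then have "cyclic_dist_sum x y l - \<epsilon> < (\<Sum>i\<leftarrow>l. dist (x i) (y i))"
      using slack[OF set_l] by simp
    with dist_l set_l show ?thesis by (intro exI[of _ l]) (auto simp: l_def)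
  qed
  have mono: "(\<Sum>i\<leftarrow>l. dist (x i) (y i)) \<le> cyclic_dist_sum x y l" if "set l \<subseteq> {1..n}" for l
    using cyclic_sum_nonneg[of l "\<lambda>i j. a (fst (e i)) (fst (e j))"] a_nonneg slack[OF that] by simp
  define Q where "Q = x ` {1..n} \<union> y ` {1..n}"
  have Q: "finite Q" "Q \<noteq> {}" using n by (auto simp: Q_def)
  have AQ: "p \<in> Q" "q \<in> Q" if "(p, q) \<in> A" for p q
    using xy_ex[OF that] unfolding Q_def by blast+
  \<comment> \<open>A family point lies on its own pair. For any other \<open>z\<close>, the largest
    and the smallest extension of \<open>f0\<close> are both tight on \<open>A\<close>, hence within
    \<kappa> of \<open>f0\<close> at \<open>z\<close>; the former supplies \<open>s\<close>, the
    latter \<open>t\<close>.\<close>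
  have near_st: "\<exists>s\<in>Q. \<exists>t\<in>Q. s \<noteq> t \<and> dist z s + dist z t \<le> f0 t - f0 s + 2 * \<kappa>" for z
  proof (cases "z \<in> Q")
    case True
    then obtain i where i: "i \<in> {1..n}" "z = x i \<or> z = y i" by (auto simp: Q_def)
    have "x i \<in> Q" "y i \<in> Q" using i(1) by (auto simp: Q_def)
    moreover have "x i \<noteq> y i" "f0 (x i) - f0 (y i) = dist (x i) (y i)" using tight[OF xyA[OF i(1)]] by auto
    ultimately show ?thesis using i(2) \<open>0 \<le> \<kappa>\<close>
      by (intro bexI[of _ "y i"] bexI[of _ "x i"]) (auto simp: dist_commute)
  next
    case False
    have lipQ: "f0 p - f0 q \<le> dist p q" for p q using f0 by (simp add: lipschitz_on_1_real_iff)
    obtain g where g: "1-lipschitz_on UNIV g" "\<And>p. p \<in> Q \<Longrightarrow> g p = f0 p" "\<And>z. \<exists>p\<in>Q. f0 p + dist z p \<le> g z"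
      using lipschitz_extension_largest[OF Q, of f0] lipQ by blast
    obtain h where h: "1-lipschitz_on UNIV h" "\<And>p. p \<in> Q \<Longrightarrow> h p = f0 p" "\<And>z. \<exists>p\<in>Q. h z \<le> f0 p - dist z p"
      using lipschitz_extension_smallest[OF Q, of f0] lipQ by blast
    obtain s t where st: "s \<in> Q" "t \<in> Q" "f0 s + dist z s \<le> g z" "h z \<le> f0 t - dist z t"
      using g(3) h(3) by blast
    have "\<bar>(g z - f0 z) - (g s - f0 s)\<bar> \<le> \<kappa>"
    proof (rule osc_tight[OF g(1)])
      show "g p - g q = dist p q" if "(p, q) \<in> A" for p q
        using AQ[OF that] tight[OF that] by (simp add: g(2))
    qed
    moreover have "\<bar>(h z - f0 z) - (h s - f0 s)\<bar> \<le> \<kappa>"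
    proof (rule osc_tight[OF h(1)])
      show "h p - h q = dist p q" if "(p, q) \<in> A" for p q
        using AQ[OF that] tight[OF that] by (simp add: h(2))
    qed
    ultimately have le: "dist z s + dist z t \<le> f0 t - f0 s + 2 * \<kappa>"
      using st(3,4) g(2)[OF st(1)] h(2)[OF st(1)] by linarith
    \<comment> \<open>Equality would place \<open>z\<close> within
      \<open>\<kappa> < \<theta>\<close> of a family point, although it is none itself.\<close>
    have "s \<noteq> t"
    proof
      assume "s = t"
      then have "dist z s \<le> \<kappa>" using le by simp
      moreover have "\<theta> \<le> dist z s" using False st(1) by (intro \<theta>) auto
      ultimately show False using \<kappa>(2) by simp
    qed
    with le st(1,2) show ?thesis by blast
  qed
  have determined: "\<exists>s\<in>Q. \<exists>t\<in>Q. s \<noteq> t \<and> dist z s + dist z t < dist s t + \<epsilon> \<and>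
      (\<forall>f :: 'a \<Rightarrow> real. 1-lipschitz_on UNIV f \<and>
        (\<forall>i\<in>{1..n}. f (x i) - f (y i) > dist (x i) (y i) * (1 - \<alpha>)) \<longrightarrow> f t - f s > dist s t - \<epsilon>)"
    for z
  proof -
    obtain s t where st: "s \<in> Q" "t \<in> Q" "s \<noteq> t" "dist z s + dist z t \<le> f0 t - f0 s + 2 * \<kappa>"
      using near_st[of z] by blast
    have "f0 t - f0 s \<le> dist s t" using f0 by (metis lipschitz_on_1_real_iff dist_commute)
    then have "dist z s + dist z t < dist s t + \<epsilon>" using st(4) \<kappa> \<open>0 \<le> \<kappa>\<close> by linarith
    moreover have "f t - f s > dist s t - \<epsilon>"
      if f: "1-lipschitz_on UNIV f" "\<forall>i\<in>{1..n}. f (x i) - f (y i) > dist (x i) (y i) * (1 - \<alpha>)" for f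
    proof -
      \<comment> \<open>This \<kappa> and the \<open>2 * \<kappa>\<close> in the choice of
        \<open>s\<close> and \<open>t\<close> add up to the \<open>3 * \<kappa> < \<epsilon>\<close>
        of the hypothesis.\<close>
      have "\<bar>(f t - f0 t) - (f s - f0 s)\<bar> \<le> \<kappa>"
      proof (rule osc[OF f(1)])
        fix p q assume "(p, q) \<in> A"
        then obtain i where "i \<in> {1..n}" "x i = p" "y i = q" using xy_ex by blast
        with f(2) show "dist p q * (1 - \<alpha>) < f p - f q" by blast
      qed
      moreover have "dist s t \<le> dist z s + dist z t" by (rule dist_triangle3)
      ultimately show ?thesis using st(4) \<kappa>(1) by linarith
    qed
    ultimately show ?thesis using st(1,2,3) by blast
  qed
  have "small_slice_family \<epsilon> \<alpha> n x y"
    unfolding small_slice_family_def Q_def[symmetric]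
    using tight[OF xyA] cycles mono determined by blast
  with n show ?thesis by blast
qed

theorem theorem2p5:
  assumes "uniform_discrete (UNIV :: 'a::{metric_space,zero} set)"
    and "bounded (UNIV :: 'a set)"
    and "\<exists>p q :: 'a. p \<noteq> q"
  shows
    "(\<not> rough_norm TYPE('a lipfree) \<longleftrightarrow> dual_wstar_BDP TYPE('a lipfree)) \<and>
     (dual_wstar_BDP TYPE('a lipfree) \<longleftrightarrow>
       (\<forall>\<epsilon>>0. \<exists>\<alpha>>0. \<exists>n\<ge>1. \<exists>(x :: nat \<Rightarrow> 'a) (y :: nat \<Rightarrow> 'a).
          (\<forall>i\<in>{1..n}. x i \<noteq> y i) \<and>
          \<comment> \<open>(a)\<close>
          (\<forall>j\<in>{1..n}. \<forall>k\<in>{1..n}. j \<noteq> k \<longrightarrow>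
             (\<exists>is. distinct is \<and> set is \<subseteq> {1..n} \<and> j \<in> set is \<and> k \<in> set is \<and>
                cyclic_dist_sum x y is - \<epsilon> < (\<Sum>i\<leftarrow>is. dist (x i) (y i)))) \<and>
          \<comment> \<open>(b)\<close>
          (\<forall>is. is \<noteq> [] \<and> set is \<subseteq> {1..n} \<longrightarrow>
             (\<Sum>i\<leftarrow>is. dist (x i) (y i)) \<le> cyclic_dist_sum x y is) \<and>
          \<comment> \<open>(c)\<close>
          (\<forall>z. \<exists>s\<in>x ` {1..n} \<union> y ` {1..n}. \<exists>t\<in>x ` {1..n} \<union> y ` {1..n}.
             s \<noteq> t \<and> dist z s + dist z t < dist s t + \<epsilon> \<and>
             (\<forall>f :: 'a \<Rightarrow> real. 1-lipschitz_on UNIV f \<and>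
                 (\<forall>i\<in>{1..n}. f (x i) - f (y i) > dist (x i) (y i) * (1 - \<alpha>)) \<longrightarrow>
                 f t - f s > dist s t - \<epsilon>))))"
proof -
  obtain \<theta> where \<theta>: "\<theta> > 0" "\<And>x y :: 'a. x \<noteq> y \<Longrightarrow> \<theta> \<le> dist x y"
    using assms(1) unfolding uniform_discrete_def by (metis UNIV_I linorder_not_less)
  obtain b where b: "\<And>x y :: 'a. dist x y \<le> b"
    using assms(2) by (auto simp: bounded_two_points)
  define D where "D = max b 1"
  have D: "D > 0" "\<And>x y :: 'a. dist x y \<le> D" using b by (auto simp: D_def le_max_iff_disj)
  have rough: "\<not> rough_norm TYPE('a lipfree) \<longleftrightarrow> dual_wstar_BDP TYPE('a lipfree)"
    using rough_if_not_dual_wstar_BDP not_rough_if_dual_wstar_BDP[OF lipfree_norming_dual] by blast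
  have family: "\<exists>\<alpha>>0. \<exists>n\<ge>1. \<exists>x y :: nat \<Rightarrow> 'a. small_slice_family \<epsilon> \<alpha> n x y"
    if BDP: "dual_wstar_BDP TYPE('a lipfree)" and \<epsilon>: "\<epsilon> > 0" for \<epsilon>
  proof -
    define \<kappa> where "\<kappa> = min \<epsilon> \<theta> / 4"
    have \<kappa>: "\<kappa> > 0" "3 * \<kappa> < \<epsilon>" "\<kappa> < \<theta>" using \<epsilon> \<theta>(1) by (auto simp: \<kappa>_def)
    \<comment> \<open>A Lipschitz norm of at most \<open>\<kappa> / D\<close> means an oscillation
      of at most \<kappa> on a space of diameter at most \<open>D\<close>.\<close>
    have "\<kappa> / D > 0" using \<kappa>(1) D(1) by simp
    from tight_pairs_if_dual_wstar_BDP[OF BDP this] obtain A \<alpha> and f0 :: "'a \<Rightarrow> real"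
      where A: "finite A" "A \<noteq> {}" "1-lipschitz_on UNIV f0"
        and tight: "\<forall>(p, q)\<in>A. p \<noteq> q \<and> f0 p - f0 q = dist p q" and \<alpha>: "\<alpha> > 0"
        and osc: "\<forall>f g z w. 1-lipschitz_on UNIV f \<and> 1-lipschitz_on UNIV g \<and>
          (\<forall>(p, q)\<in>A. dist p q * (1 - \<alpha>) < f p - f q) \<and>
          (\<forall>(p, q)\<in>A. dist p q * (1 - \<alpha>) < g p - g q) \<longrightarrow>
          \<bar>(f z - g z) - (f w - g w)\<bar> \<le> \<kappa> / D * dist z w"
      by (elim exE conjE)
    have near: "\<forall>(p, q)\<in>A. dist p q * (1 - \<alpha>) < f0 p - f0 q"
      using tight \<alpha> by (auto simp: algebra_simps)
    have "\<exists>n\<ge>1. \<exists>x y :: nat \<Rightarrow> 'a. small_slice_family \<epsilon> \<alpha> n x y"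
    proof (rule small_slice_family_if_tight_pairs[OF A _ \<alpha> _ \<kappa>(2,3) \<theta>(2)])
      show "p \<noteq> q \<and> f0 p - f0 q = dist p q" if "(p, q) \<in> A" for p q using tight that by blast
      fix f :: "'a \<Rightarrow> real" and z w
      assume "1-lipschitz_on UNIV f" "\<And>p q. (p, q) \<in> A \<Longrightarrow> dist p q * (1 - \<alpha>) < f p - f q"
      then have "\<bar>(f z - f0 z) - (f w - f0 w)\<bar> \<le> \<kappa> / D * dist z w"
        using A(3) near by (intro osc[rule_format]) auto
      also have "\<dots> \<le> \<kappa> / D * D" using \<kappa>(1) D by (intro mult_left_mono) auto
      finally show "\<bar>(f z - f0 z) - (f w - f0 w)\<bar> \<le> \<kappa>" using D(1) by simp
    qed
    with \<alpha> show ?thesis by blast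
  qed
  have "dual_wstar_BDP TYPE('a lipfree) \<longleftrightarrow>
      (\<forall>\<epsilon>>0. \<exists>\<alpha>>0. \<exists>n\<ge>1. \<exists>x y :: nat \<Rightarrow> 'a. small_slice_family \<epsilon> \<alpha> n x y)"
    using family dual_wstar_BDP_if_small_slice_family[OF \<theta> D] by blast
  from conjI[OF rough this[unfolded small_slice_family_def]] show ?thesis .
qed

end
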